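(* For each $d$ let $W_d\subset H_d$ be a complex linear subspace of dimension $k_d$, with $k_d\asymp d^m$, and let $\mu_{W_d}$ be the Haar probability measure on the unit sphere $SW_d$. Let $$\alpha_d:=\sup_{x\in M}\frac{\Pi_{W_d}(x,x)}{k_d}.$$ Then there exists $C>0$ such that, as $d\to\infty$, $$\mu_{W_d}\Big\{s\in SW_d:\ \|s\|_{L^\infty(M)}>C\sqrt{\alpha_d\log d}\Big\}=O(d^{-1}),$$ and, more generally, for every $j\in\mathbb{Z}_+$ there exists $C=C(j)>0$ such that the left-hand side (with $C=C(j)$) is $O(d^{-j})$.
   Context: $M$ is a compact complex algebraic manifold of complex dimension $m$, $(L,h)$ is a positive hermitian line bundle on $M$, and $H_d:=H^0(M,L^d)$ is the space of holomorphic sections of $L^{d}=L^{\otimes d}$. The metric $h$ induces pointwise norms $|s(x)|$ on $L^d$ and an $L^2$ hermitian inner product $\langle\cdot,\cdot\rangle$ with norm $\|\cdot\|$ on $H_d$ (integration is with respect to the volume form of the Kähler metric given by the curvature form of $(L,h)$). Here $\|s\|_{L^\infty(M)}=\sup_{x\in M}|s(x)|$. For a complex linear subspace $W_d\subset H_d$, $SW_d=\{s\in W_d:\|s\|=1\}$ denotes its unit sphere, and $\mu_{W_d}$ is the uniform (unitarily invariant) probability measure on $SW_d$. For an orthonormal basis $S_1^d,\dots,S_{k_d}^d$ of $W_d$, the reproducing kernel is $\Pi_{W_d}(x,y)=\sum_{j=1}^{k_d}S_j^d(x)\overline{S_j^d(y)}$; on the diagonal, $\Pi_{W_d}(x,x)=\sum_{j=1}^{k_d}|S_j^d(x)|^2$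 (pointwise norms), which does not depend on the basis. The notation $k_d\asymp d^m$ means that $k_d/d^m$ is bounded above and below by positive constants for all large $d$. *)

theory Defs
  imports "HOL-Analysis.Analysis" "HOL-Library.Landau_Symbols" "HOL-Library.Function_Algebras"
begin

text \<open>
  For open \<open>S\<close> in a finite-dimensional space this is the usual notion of a function of class
  \<open>C\<^sup>n\<close>: all directional derivatives are of class \<open>C\<^sup>n\<^sup>-\<^sup>1\<close>.
\<close>

primrec Ck_on ::
  "nat \<Rightarrow> ('a::real_normed_vector \<Rightarrow> 'b::real_normed_vector) \<Rightarrow> 'a set \<Rightarrow> bool" where
  "Ck_on 0 f S \<longleftrightarrow> continuous_on S f"
| "Ck_on (Suc n) f S \<longleftrightarrow>
     (\<forall>x\<in>S. f differentiable (at x)) \<and>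
     (\<forall>v. Ck_on n (\<lambda>x. frechet_derivative f (at x) v) S)"

definition smooth_fun_on ::
  "('a::real_normed_vector \<Rightarrow> 'b::real_normed_vector) \<Rightarrow> 'a set \<Rightarrow> bool" where
  "smooth_fun_on f S \<longleftrightarrow> (\<forall>n. Ck_on n f S)"

text \<open>Holomorphy in several variables: the real derivative exists and is complex linear.\<close>

definition hol_fun_on :: "(complex^'m \<Rightarrow> complex) \<Rightarrow> (complex^'m) set \<Rightarrow> bool" where
  "hol_fun_on f S \<longleftrightarrow>
     (\<forall>z\<in>S. \<exists>f'. (f has_derivative f') (at z) \<and> (\<forall>c v. f' (c *s v) = c * f' v))"

text \<open>The Wirtinger derivatives \<open>\<partial>f/\<partial>z\<^sub>j\<close> and \<open>\<partial>f/\<partial>cnj(z\<^sub>j)\<close> (\<open>axis j 1\<close> and \<open>axis j \<i>\<close> are the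
  directions of \<open>x\<^sub>j\<close> and \<open>y\<^sub>j\<close>).\<close>

definition wirtinger :: "'m::finite \<Rightarrow> (complex^'m \<Rightarrow> complex) \<Rightarrow> complex^'m \<Rightarrow> complex" where
  "wirtinger j f z =
     (frechet_derivative f (at z) (axis j 1) - \<i> * frechet_derivative f (at z) (axis j \<i>)) / 2"

definition wirtinger_bar :: "'m::finite \<Rightarrow> (complex^'m \<Rightarrow> complex) \<Rightarrow> complex^'m \<Rightarrow> complex" where
  "wirtinger_bar j f z =
     (frechet_derivative f (at z) (axis j 1) + \<i> * frechet_derivative f (at z) (axis j \<i>)) / 2"


text \<open>Complex manifolds: the underlying space is a whole type \<open>'p\<close>, the complex structure is
  given by a set of charts \<open>(U, \<phi>)\<close> with \<open>\<phi>\<close> meaningful on \<open>U\<close> only.\<close>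

type_synonym ('p, 'm) chart = "'p set \<times> ('p \<Rightarrow> complex^'m)"

definition hol_atlas :: "('p::topological_space, 'm::finite) chart set \<Rightarrow> bool" where
  "hol_atlas \<A> \<longleftrightarrow>
     (\<forall>(U, \<phi>)\<in>\<A>. open U \<and> open (\<phi> ` U) \<and> homeomorphism U (\<phi> ` U) \<phi> (inv_into U \<phi>)) \<and>
     (\<Union>(U, \<phi>)\<in>\<A>. U) = UNIV \<and>
     (\<forall>(U, \<phi>)\<in>\<A>. \<forall>(V, \<psi>)\<in>\<A>. \<forall>j.
        hol_fun_on (\<lambda>z. \<psi> (inv_into U \<phi> z) $ j) (\<phi> ` (U \<inter> V)))"

definition hol_on_mfd ::
  "('p::topological_space, 'm::finite) chart set \<Rightarrow> 'p set \<Rightarrow> ('p \<Rightarrow> complex) \<Rightarrow> bool" where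
  "hol_on_mfd \<A> D f \<longleftrightarrow>
     (\<forall>(U, \<phi>)\<in>\<A>. hol_fun_on (\<lambda>z. f (inv_into U \<phi> z)) (\<phi> ` (U \<inter> D)))"

definition smooth_on_mfd ::
  "('p::topological_space, 'm::finite) chart set \<Rightarrow> 'p set \<Rightarrow> ('p \<Rightarrow> real) \<Rightarrow> bool" where
  "smooth_on_mfd \<A> D f \<longleftrightarrow>
     (\<forall>(U, \<phi>)\<in>\<A>. smooth_fun_on (\<lambda>z. f (inv_into U \<phi> z)) (\<phi> ` (U \<inter> D)))"

definition compact_complex_manifold ::
  "('p::t2_space, 'm::finite) chart set \<Rightarrow> bool" where
  "compact_complex_manifold \<A> \<longleftrightarrow> compact (UNIV :: 'p set) \<and> hol_atlas \<A>"

text \<open>Homogeneous polynomial functions in the variables \<open>w 0, \<dots>, w N\<close>.\<close>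

definition homogeneous_poly :: "nat \<Rightarrow> ((nat \<Rightarrow> complex) \<Rightarrow> complex) \<Rightarrow> bool" where
  "homogeneous_poly N P \<longleftrightarrow>
     (\<exists>e (E :: (nat \<Rightarrow> nat) set) c. finite E \<and> (\<forall>a\<in>E. (\<Sum>i\<le>N. a i) = e) \<and>
        P = (\<lambda>w. \<Sum>a\<in>E. c a * (\<Prod>i\<le>N. w i ^ a i)))"

text \<open>
  The manifold is (biholomorphic to) a nonsingular algebraic subset of \<open>\<complex>\<P>\<^sup>N\<close>. Here \<open>F p\<close> is any
  choice of homogeneous coordinates of the image of \<open>p\<close>, and the map to \<open>\<complex>\<P>\<^sup>N\<close> is required to be
  well defined, holomorphic, injective and immersive, with image the zero set of
  homogeneous polynomials. The lift \<open>F\<close> itself need not be continuous, only its ratios are used.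
\<close>

definition algebraic_manifold ::
  "('p::topological_space, 'm::finite) chart set \<Rightarrow> bool" where
  "algebraic_manifold \<A> \<longleftrightarrow>
     (\<exists>N (F :: 'p \<Rightarrow> nat \<Rightarrow> complex).
        (\<forall>p. \<exists>i\<le>N. F p i \<noteq> 0) \<and>
        (\<forall>i\<le>N. open {p. F p i \<noteq> 0} \<and>
           (\<forall>k\<le>N. hol_on_mfd \<A> {p. F p i \<noteq> 0} (\<lambda>p. F p k / F p i))) \<and>
        (\<forall>p q. (\<exists>c. \<forall>i\<le>N. F p i = c * F q i) \<longrightarrow> p = q) \<and>
        (\<forall>(U, \<phi>)\<in>\<A>. \<forall>p\<in>U. \<forall>i\<le>N. F p i \<noteq> 0 \<longrightarrow>
           (\<forall>v. v \<noteq> 0 \<longrightarrow> (\<exists>k\<le>N.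
              frechet_derivative (\<lambda>z. F (inv_into U \<phi> z) k / F (inv_into U \<phi> z) i)
                (at (\<phi> p)) v \<noteq> 0))) \<and>
        (\<exists>\<P>. (\<forall>P\<in>\<P>. homogeneous_poly N P) \<and>
           (\<forall>w. (\<exists>i\<le>N. w i \<noteq> 0) \<longrightarrow>
              (\<forall>P\<in>\<P>. P w = 0) \<longleftrightarrow> (\<exists>p c. c \<noteq> 0 \<and> (\<forall>i\<le>N. w i = c * F p i)))))"


text \<open>
  A holomorphic line bundle is given by a trivializing open cover \<open>bdom i\<close> (\<open>i \<in> bidx\<close>) and its
  transition functions. If \<open>e\<^sub>i\<close> denotes the frame over \<open>bdom i\<close>, then \<open>e\<^sub>j = btrans i j \<cdot> e\<^sub>i\<close>,
  so the coefficients of a section \<open>s = s\<^sub>i e\<^sub>i\<close> of \<open>L\<close> satisfy \<open>s\<^sub>i = btrans i j \<cdot> s\<^sub>j\<close>.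
\<close>

record ('p, 'i) line_bundle =
  bidx :: "'i set"
  bdom :: "'i \<Rightarrow> 'p set"
  btrans :: "'i \<Rightarrow> 'i \<Rightarrow> 'p \<Rightarrow> complex"

definition hol_line_bundle ::
  "('p::topological_space, 'm::finite) chart set \<Rightarrow> ('p, 'i) line_bundle \<Rightarrow> bool" where
  "hol_line_bundle \<A> L \<longleftrightarrow>
     (\<forall>i\<in>bidx L. open (bdom L i)) \<and>
     (\<Union>i\<in>bidx L. bdom L i) = UNIV \<and>
     (\<forall>i\<in>bidx L. \<forall>j\<in>bidx L.
        hol_on_mfd \<A> (bdom L i \<inter> bdom L j) (btrans L i j) \<and>
        (\<forall>p\<in>bdom L i \<inter> bdom L j. btrans L i j p \<noteq> 0)) \<and>
     (\<forall>i\<in>bidx L. \<forall>j\<in>bidx L. \<forall>k\<in>bidx L. \<forall>p\<in>bdom L i \<inter> bdom L j \<inter> bdom L k.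
        btrans L i j p * btrans L j k p = btrans L i k p)"

text \<open>A hermitian metric is given by the functions \<open>h i p = |e\<^sub>i(p)|\<^sup>2\<close>.\<close>

definition hermitian_metric ::
  "('p::topological_space, 'm::finite) chart set \<Rightarrow> ('p, 'i) line_bundle \<Rightarrow>
   ('i \<Rightarrow> 'p \<Rightarrow> real) \<Rightarrow> bool" where
  "hermitian_metric \<A> L h \<longleftrightarrow>
     (\<forall>i\<in>bidx L. smooth_on_mfd \<A> (bdom L i) (h i) \<and> (\<forall>p\<in>bdom L i. h i p > 0)) \<and>
     (\<forall>i\<in>bidx L. \<forall>j\<in>bidx L. \<forall>p\<in>bdom L i \<inter> bdom L j.
        h j p = (cmod (btrans L i j p))\<^sup>2 * h i p)"

text \<open>
  The coefficient matrix \<open>g\<^sub>j\<^sub>k = - \<partial>\<^sup>2 log |e\<^sub>i|\<^sup>2 / \<partial>z\<^sub>j \<partial>cnj(z\<^sub>k)\<close>, in the chart \<open>(U, \<phi>)\<close>, of the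
  curvature form \<open>\<Theta> = \<Sum> g\<^sub>j\<^sub>k dz\<^sub>j \<and> d cnj(z\<^sub>k)\<close>.
\<close>

definition curvature_matrix ::
  "('p, 'm::finite) chart \<Rightarrow> ('p \<Rightarrow> real) \<Rightarrow> complex^'m \<Rightarrow> complex^'m^'m" where
  "curvature_matrix ch u z =
     (\<chi> j k. - wirtinger j (wirtinger_bar k
        (\<lambda>w. complex_of_real (ln (u (inv_into (fst ch) (snd ch) w))))) z)"

definition positive_metric ::
  "('p::topological_space, 'm::finite) chart set \<Rightarrow> ('p, 'i) line_bundle \<Rightarrow>
   ('i \<Rightarrow> 'p \<Rightarrow> real) \<Rightarrow> bool" where
  "positive_metric \<A> L h \<longleftrightarrow>
     (\<forall>(U, \<phi>)\<in>\<A>. \<forall>i\<in>bidx L. \<forall>p\<in>U \<inter> bdom L i. \<forall>v. v \<noteq> 0 \<longrightarrow>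
        0 < Re (\<Sum>j\<in>UNIV. \<Sum>k\<in>UNIV.
              curvature_matrix (U, \<phi>) (h i) (\<phi> p) $ j $ k * v $ j * cnj (v $ k)))"

text \<open>
  The measure of the volume form \<open>\<omega>\<^sup>m/m!\<close> of the Kaehler form \<open>\<omega> = (\<i>/2) \<Theta>\<close>. Since
  \<open>(\<i>/2) dz \<and> d cnj(z) = dx \<and> dy\<close>, its density with respect to Lebesgue measure in a chart is
  \<open>det g\<close>. This determines the measure, because chart domains intersected with trivializing
  open sets cover the manifold.
\<close>

definition kaehler_volume ::
  "('p::topological_space, 'm::finite) chart set \<Rightarrow> ('p, 'i) line_bundle \<Rightarrow>
   ('i \<Rightarrow> 'p \<Rightarrow> real) \<Rightarrow> 'p measure \<Rightarrow> bool" where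
  "kaehler_volume \<A> L h vol \<longleftrightarrow>
     sets vol = sets borel \<and>
     (\<forall>(U, \<phi>)\<in>\<A>. \<forall>i\<in>bidx L. \<forall>E\<in>sets borel. E \<subseteq> U \<inter> bdom L i \<longrightarrow>
        emeasure vol E =
          (\<integral>\<^sup>+ z\<in>\<phi> ` E. ennreal (Re (det (curvature_matrix (U, \<phi>) (h i) z))) \<partial>lborel))"


text \<open>
  A section of a power of \<open>L\<close> is the family of its coefficients \<open>s i\<close> in the frames
  \<open>e\<^sub>i\<^sup>\<otimes>\<^sup>d\<close>, extended by \<open>0\<close> so that a section has exactly one representation. Addition of
  sections is the pointwise addition of functions.
\<close>

type_synonym ('p, 'i) bsection = "'i \<Rightarrow> 'p \<Rightarrow> complex"

definition sscale :: "complex \<Rightarrow> ('p, 'i) bsection \<Rightarrow> ('p, 'i) bsection" where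
  "sscale c s = (\<lambda>i p. c * s i p)"

lemma vector_space_sscale: "vector_space (sscale :: complex \<Rightarrow> ('p, 'i) bsection \<Rightarrow> _)"
  by unfold_locales (auto simp: sscale_def fun_eq_iff algebra_simps)

definition H0 ::
  "('p::topological_space, 'm::finite) chart set \<Rightarrow> ('p, 'i) line_bundle \<Rightarrow> nat \<Rightarrow>
   ('p, 'i) bsection set" where
  "H0 \<A> L d =
     {s. (\<forall>i\<in>bidx L. hol_on_mfd \<A> (bdom L i) (s i)) \<and>
         (\<forall>i\<in>bidx L. \<forall>j\<in>bidx L. \<forall>p\<in>bdom L i \<inter> bdom L j.
            s i p = btrans L i j p ^ d * s j p) \<and>
         (\<forall>i p. i \<notin> bidx L \<or> p \<notin> bdom L i \<longrightarrow> s i p = 0)}"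

definition frame_at :: "('p, 'i) line_bundle \<Rightarrow> 'p \<Rightarrow> 'i" where
  "frame_at L p = (SOME i. i \<in> bidx L \<and> p \<in> bdom L i)"

text \<open>The pointwise hermitian product and norm on \<open>L\<^sup>d\<close> (independent of the frame used).\<close>

definition pt_inner ::
  "('p, 'i) line_bundle \<Rightarrow> ('i \<Rightarrow> 'p \<Rightarrow> real) \<Rightarrow> nat \<Rightarrow> ('p, 'i) bsection \<Rightarrow>
   ('p, 'i) bsection \<Rightarrow> 'p \<Rightarrow> complex" where
  "pt_inner L h d s t p =
     (let i = frame_at L p in s i p * cnj (t i p) * complex_of_real (h i p ^ d))"

definition pt_norm ::
  "('p, 'i) line_bundle \<Rightarrow> ('i \<Rightarrow> 'p \<Rightarrow> real) \<Rightarrow> nat \<Rightarrow> ('p, 'i) bsection \<Rightarrow> 'p \<Rightarrow> real" where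
  "pt_norm L h d s p = sqrt (Re (pt_inner L h d s s p))"

definition sup_norm ::
  "('p, 'i) line_bundle \<Rightarrow> ('i \<Rightarrow> 'p \<Rightarrow> real) \<Rightarrow> nat \<Rightarrow> ('p, 'i) bsection \<Rightarrow> real" where
  "sup_norm L h d s = (SUP p. pt_norm L h d s p)"

definition L2_inner ::
  "('p, 'i) line_bundle \<Rightarrow> ('i \<Rightarrow> 'p \<Rightarrow> real) \<Rightarrow> 'p measure \<Rightarrow> nat \<Rightarrow> ('p, 'i) bsection \<Rightarrow>
   ('p, 'i) bsection \<Rightarrow> complex" where
  "L2_inner L h vol d s t = (\<integral>p. pt_inner L h d s t p \<partial>vol)"

definition L2_norm ::
  "('p, 'i) line_bundle \<Rightarrow> ('i \<Rightarrow> 'p \<Rightarrow> real) \<Rightarrow> 'p measure \<Rightarrow> nat \<Rightarrow> ('p, 'i) bsection \<Rightarrow> real" where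
  "L2_norm L h vol d s = sqrt (Re (L2_inner L h vol d s s))"

definition orthonormal_basis ::
  "('p, 'i) line_bundle \<Rightarrow> ('i \<Rightarrow> 'p \<Rightarrow> real) \<Rightarrow> 'p measure \<Rightarrow> nat \<Rightarrow>
   ('p, 'i) bsection set \<Rightarrow> ('p, 'i) bsection set \<Rightarrow> bool" where
  "orthonormal_basis L h vol d W B \<longleftrightarrow>
     finite B \<and> B \<subseteq> W \<and> W \<subseteq> module.span sscale B \<and>
     (\<forall>s\<in>B. \<forall>t\<in>B. L2_inner L h vol d s t = (if s = t then 1 else 0))"

text \<open>The reproducing kernel on the diagonal; it does not depend on the chosen basis.\<close>

definition kernel_diag ::
  "('p, 'i) line_bundle \<Rightarrow> ('i \<Rightarrow> 'p \<Rightarrow> real) \<Rightarrow> 'p measure \<Rightarrow> nat \<Rightarrow>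
   ('p, 'i) bsection set \<Rightarrow> 'p \<Rightarrow> real" where
  "kernel_diag L h vol d W x =
     (\<Sum>s\<in>(SOME B. orthonormal_basis L h vol d W B). (pt_norm L h d s x)\<^sup>2)"

definition unit_sphere ::
  "('p, 'i) line_bundle \<Rightarrow> ('i \<Rightarrow> 'p \<Rightarrow> real) \<Rightarrow> 'p measure \<Rightarrow> nat \<Rightarrow>
   ('p, 'i) bsection set \<Rightarrow> ('p, 'i) bsection set" where
  "unit_sphere L h vol d W = {s \<in> W. L2_norm L h vol d s = 1}"

definition unitary_on ::
  "('p, 'i) line_bundle \<Rightarrow> ('i \<Rightarrow> 'p \<Rightarrow> real) \<Rightarrow> 'p measure \<Rightarrow> nat \<Rightarrow>
   ('p, 'i) bsection set \<Rightarrow> (('p, 'i) bsection \<Rightarrow> ('p, 'i) bsection) \<Rightarrow> bool" where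
  "unitary_on L h vol d W T \<longleftrightarrow>
     bij_betw T W W \<and>
     (\<forall>s\<in>W. \<forall>t\<in>W. T (s + t) = T s + T t) \<and>
     (\<forall>c. \<forall>s\<in>W. T (sscale c s) = sscale c (T s)) \<and>
     (\<forall>s\<in>W. \<forall>t\<in>W. L2_inner L h vol d (T s) (T t) = L2_inner L h vol d s t)"

text \<open>
  The unitarily invariant probability measure on the unit sphere, as a Borel measure.
  \<open>borel\<close> on the function type refers to the topology of pointwise convergence, which on a
  finite-dimensional space of sections is the only Hausdorff vector space topology, hence the
  one of the \<open>L\<^sup>2\<close> norm. On such a space \<open>{s. sup_norm L h d s > c}\<close> is a union of
  relatively open sets, and so an event.
\<close>

definition haar_sphere_measure ::
  "('p, 'i) line_bundle \<Rightarrow> ('i \<Rightarrow> 'p \<Rightarrow> real) \<Rightarrow> 'p measure \<Rightarrow> nat \<Rightarrow>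
   ('p, 'i) bsection set \<Rightarrow> ('p, 'i) bsection measure \<Rightarrow> bool" where
  "haar_sphere_measure L h vol d W \<mu> \<longleftrightarrow>
     space \<mu> = unit_sphere L h vol d W \<and>
     sets \<mu> = sets (restrict_space borel (unit_sphere L h vol d W)) \<and>
     emeasure \<mu> (space \<mu>) = 1 \<and>
     (\<forall>T. unitary_on L h vol d W T \<longrightarrow> distr \<mu> \<mu> T = \<mu>)"

end

theory Submission
  imports Defs "HOL-Complex_Analysis.Complex_Analysis"
begin

text \<open>
  A random unit section is controlled at one point by unitary invariance, at polynomially many points
  by a union bound, and at all other points because holomorphic sections of the \<open>d\<close>-th power barely
  change at distance \<open>1/d\<close>.

  \<^bold>\<open>One point.\<close> In an orthonormal basis, the value \<open>s(x)\<close> is the inner product of \<open>s\<close> with a coherent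
  state whose squared norm is the reproducing kernel \<open>\<Pi>(x,x)\<close>. So everything depends on the moments
  \<open>M\<^sub>n\<close> of \<open>|\<langle>s,u\<rangle>|\<^sup>2\<close> for a unit vector \<open>u\<close>. By invariance \<open>M\<^sub>n\<close> does not depend on \<open>u\<close>; taking
  \<open>u\<close> along \<open>e + t f\<close> with \<open>e, f\<close> orthonormal shows that the mean of \<open>|\<langle>s,e\<rangle> + t \<langle>s,f\<rangle>|\<close> to the power
  \<open>2n\<close> equals \<open>(1+t\<^sup>2)\<^sup>n M\<^sub>n\<close>. Comparing the coefficients of \<open>t\<^sup>2\<close> bounds \<open>M\<^sub>n\<close> by a
  mixed moment (\<open>mixed_moment\<close>), and summing over the basis gives \<open>k M\<^sub>n \<le> 2n M\<^sub>n\<^sub>-\<^sub>1\<close>, hence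
  \<open>M\<^sub>n \<le> (2n/k)\<^sup>n\<close> (\<open>moment_bound\<close>). Markov's inequality turns this into a tail bound at the point
  (\<open>eval_tail\<close>).

  \<^bold>\<open>All points.\<close> In a chart and a frame, \<open>|s|\<close> is \<open>|f| u\<^sup>d\<^sup>/\<^sup>2\<close> with \<open>f\<close> holomorphic and \<open>u\<close> positive and
  smooth. On a ball of radius of order \<open>1/d\<close> the weight changes by a bounded factor, so that Cauchy's
  inequality on a complex line bounds the oscillation of \<open>|s|\<close> there by a small multiple of its
  supremum (\<open>weighted_oscillation\<close>). A net of mesh of order \<open>1/d\<close> has polynomially many
  points, so that \<open>sup |s|\<close> is at most four times the maximum of \<open>|s|\<close> over \<open>K d\<^sup>a\<close> points
  (\<open>global_net\<close>).

  \<^bold>\<open>Conclusion.\<close> With threshold \<open>C (\<alpha> log d)\<^sup>1\<^sup>/\<^sup>2\<close> and \<open>n\<close> about \<open>log d\<close>, the bound at one point is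
  \<open>(64/C\<^sup>2)\<^sup>n\<close>. This is at most \<open>d\<^sup>-\<^sup>(\<^sup>a\<^sup>+\<^sup>j\<^sup>)\<close> once \<open>C\<^sup>2 = 64 exp(a+j)\<close>, and the union over the net
  costs the factor \<open>K d\<^sup>a\<close>.

  Orthonormal bases require that the \<open>L\<^sup>2\<close> product is finite and positive definite. It is
  finite because the curvature is continuous, hence the volume of a compact manifold is finite
  (\<open>volume_finite\<close>). It is definite because a degenerate form has a noncompact group of isometries, and
  such a group preserves no probability measure on the unit sphere (\<open>positive_definite\<close>).
\<close>

section \<open>Finite-dimensional spaces of sections\<close>

interpretation sec: vector_space "sscale :: complex \<Rightarrow> ('p, 'i) bsection \<Rightarrow> _"
  by (rule vector_space_sscale)

lemma sscale_apply: "sscale c s i p = c * s i p"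
  by (simp add: sscale_def)

lemma sum_section_apply: "(\<Sum>j\<in>J. f j) i p = (\<Sum>j\<in>J. f j i p)"
  for f :: "'a \<Rightarrow> ('p, 'i) bsection"
  by (induction J rule: infinite_finite_induct) auto

text \<open>
  A finite-dimensional space of functions is coordinatized by evaluation at finitely many points, since a
  nonzero function is nonzero somewhere. Consequently every linear map on such a space is
  continuous for pointwise convergence, so that unitary maps act measurably on the unit sphere.
\<close>

lemma span_reconstruction:
  fixes B :: "('p, 'i) bsection set"
  assumes "finite B"
  shows "\<exists>n (e :: nat \<Rightarrow> ('p, 'i) bsection) a q. (\<forall>j<n. e j \<in> sec.span B) \<and>
           (\<forall>s\<in>sec.span B. (\<Sum>j<n. sscale (s (a j) (q j)) (e j)) = s)"
  using assms
proof induction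
  case empty
  show ?case
    by (rule exI[of _ 0]) (simp add: sec.span_empty)
next
  case (insert b B)
  then obtain n :: nat and e a q where e: "\<And>j. j < n \<Longrightarrow> e j \<in> sec.span B"
    and rec: "\<And>s. s \<in> sec.span B \<Longrightarrow> (\<Sum>j<n. sscale (s (a j) (q j)) (e j)) = s"
    by blast
  define R where "R s = (\<Sum>j<n. sscale (s (a j) (q j)) (e j))" for s
  define b' where "b' = b - R b"
  have e': "e j \<in> sec.span (insert b B)" if "j < n" for j
    using e[OF that] sec.span_mono[of B "insert b B"] by blast
  have Rsp: "R s \<in> sec.span (insert b B)" for s
    unfolding R_def by (intro sec.span_sum sec.span_scale e') auto
  have b'sp: "b' \<in> sec.span (insert b B)"
    unfolding b'_def by (intro sec.span_diff Rsp sec.span_base) auto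
  have dec: "\<exists>c. s = R s + sscale c b'" if "s \<in> sec.span (insert b B)" for s
  proof -
    from that obtain c where c: "s - sscale c b \<in> sec.span B"
      using sec.span_insert by blast
    have "s - sscale c b = R (s - sscale c b)"
      using rec[OF c] unfolding R_def by simp
    also have "\<dots> = R s - sscale c (R b)"
      by (simp add: R_def fun_eq_iff sscale_apply sum_section_apply sum_subtractf sum_distrib_left algebra_simps)
    finally have "s = R s + sscale c b'"
      by (simp add: b'_def fun_eq_iff sscale_apply algebra_simps)
    then show ?thesis by blast
  qed
  show ?case
  proof (cases "b' = 0")
    case True
    have "R s = s" if "s \<in> sec.span (insert b B)" for s
      using dec[OF that] True by auto
    then show ?thesis
      unfolding R_def using e' by blast
  next
    case False
    then obtain i p where ip: "b' i p \<noteq> 0" by (auto simp: fun_eq_iff)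
    \<comment> \<open>The residue of the new generator is normalized to take the value 1 at a new point;
        the old basis sections are corrected so as to vanish there.\<close>
    define g where "g = sscale (1 / b' i p) b'"
    define e2 where "e2 = (\<lambda>j. if j < n then e j - sscale (e j i p) g else g)"
    define a2 where "a2 = a(n := i)"
    define q2 where "q2 = q(n := p)"
    have "e2 j \<in> sec.span (insert b B)" for j
      by (auto simp: e2_def g_def intro!: sec.span_diff sec.span_scale e' b'sp)
    moreover have "(\<Sum>j<Suc n. sscale (s (a2 j) (q2 j)) (e2 j)) = s"
      if s: "s \<in> sec.span (insert b B)" for s
    proof -
      obtain c where c: "s = R s + sscale c b'" using dec[OF s] by blast
      have "s i p = R s i p + c * b' i p" by (subst c) (simp add: sscale_apply)
      then have cc: "c = (s i p - R s i p) / b' i p" using ip by (simp add: field_simps)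
      have "(\<Sum>j<n. sscale (s (a2 j) (q2 j)) (e2 j)) = R s - sscale (R s i p) g"
        by (simp add: R_def fun_eq_iff sscale_apply sum_section_apply e2_def a2_def q2_def
            right_diff_distrib sum_subtractf sum_distrib_right mult.assoc)
      then have "(\<Sum>j<Suc n. sscale (s (a2 j) (q2 j)) (e2 j))
          = R s - sscale (R s i p) g + sscale (s i p) g"
        by (simp add: e2_def a2_def q2_def)
      also have "\<dots> = R s + sscale c b'"
        by (simp add: fun_eq_iff sscale_apply g_def cc diff_divide_distrib algebra_simps)
      finally show ?thesis using c by simp
    qed
    ultimately show ?thesis by blast
  qed
qed

section \<open>Invariant measures and positive definiteness\<close>

text \<open>
  The form is only assumed to be positive semidefinite: definiteness will be a consequence of the
  existence of an invariant probability measure.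
\<close>

locale section_form =
  fixes W :: "('p, 'i) bsection set" and ip :: "('p, 'i) bsection \<Rightarrow> ('p, 'i) bsection \<Rightarrow> complex"
  assumes subsp: "sec.subspace W"
    and finite_dim: "\<exists>B. finite B \<and> B \<subseteq> W \<and> W \<subseteq> sec.span B"
    and ip_add: "\<lbrakk>s \<in> W; t \<in> W; r \<in> W\<rbrakk> \<Longrightarrow> ip (s + t) r = ip s r + ip t r"
    and ip_scale: "\<lbrakk>s \<in> W; t \<in> W\<rbrakk> \<Longrightarrow> ip (sscale c s) t = c * ip s t"
    and ip_cnj: "\<lbrakk>s \<in> W; t \<in> W\<rbrakk> \<Longrightarrow> ip t s = cnj (ip s t)"
    and ip_nonneg: "s \<in> W \<Longrightarrow> 0 \<le> Re (ip s s)"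
begin

lemmas W_add = sec.subspace_add[OF subsp]
  and W_scale = sec.subspace_scale[OF subsp]
  and W_diff = sec.subspace_diff[OF subsp]
  and W_0 = sec.subspace_0[OF subsp]
  and W_sum = sec.subspace_sum[OF subsp]

lemma ip_diff: "\<lbrakk>s \<in> W; t \<in> W; r \<in> W\<rbrakk> \<Longrightarrow> ip (s - t) r = ip s r - ip t r"
  using ip_add[of "s - t" t r] by (simp add: W_diff)

lemma ip_add_right: "\<lbrakk>s \<in> W; t \<in> W; r \<in> W\<rbrakk> \<Longrightarrow> ip r (s + t) = ip r s + ip r t"
  by (metis W_add complex_cnj_add ip_add ip_cnj)

lemma ip_diff_right: "\<lbrakk>s \<in> W; t \<in> W; r \<in> W\<rbrakk> \<Longrightarrow> ip r (s - t) = ip r s - ip r t"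
  by (metis W_diff complex_cnj_diff ip_diff ip_cnj)

lemma ip_scale_right: "\<lbrakk>s \<in> W; t \<in> W\<rbrakk> \<Longrightarrow> ip s (sscale c t) = cnj c * ip s t"
  by (metis W_scale complex_cnj_mult ip_cnj ip_scale)

lemma ip_zero: "r \<in> W \<Longrightarrow> ip 0 r = 0" "r \<in> W \<Longrightarrow> ip r 0 = 0"
  using ip_diff[of 0 0 r] ip_diff_right[of 0 0 r] W_0 by auto

lemma ip_sum: "\<lbrakk>\<And>j. j \<in> J \<Longrightarrow> f j \<in> W; r \<in> W\<rbrakk> \<Longrightarrow> ip (\<Sum>j\<in>J. f j) r = (\<Sum>j\<in>J. ip (f j) r)"
  by (induction J rule: infinite_finite_induct) (auto simp: ip_zero ip_add W_sum)

lemma ip_sum_right: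
  "\<lbrakk>\<And>j. j \<in> J \<Longrightarrow> f j \<in> W; r \<in> W\<rbrakk> \<Longrightarrow> ip r (\<Sum>j\<in>J. f j) = (\<Sum>j\<in>J. ip r (f j))"
  by (induction J rule: infinite_finite_induct) (auto simp: ip_zero ip_add_right W_sum)

lemma ip_self: "s \<in> W \<Longrightarrow> ip s s = complex_of_real (Re (ip s s))"
  using ip_cnj[of s s] by (simp add: complex_eq_iff)

lemmas ip_simps = ip_add ip_diff ip_scale ip_add_right ip_diff_right ip_scale_right
  W_add W_diff W_scale

lemma reconstruction:
  obtains n :: nat and e a q where "\<And>j. j < n \<Longrightarrow> e j \<in> W"
    "\<And>s. s \<in> W \<Longrightarrow> (\<Sum>j<n. sscale (s (a j) (q j)) (e j)) = s"
proof -
  obtain B where B: "finite B" "B \<subseteq> W" "W \<subseteq> sec.span B" using finite_dim by blast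
  have "sec.span B = W"
    using B sec.span_minimal[OF B(2) subsp] by auto
  moreover obtain n :: nat and e a q where "\<And>j. j < n \<Longrightarrow> e j \<in> sec.span B"
    "\<And>s. s \<in> sec.span B \<Longrightarrow> (\<Sum>j<n. sscale (s (a j) (q j)) (e j)) = s"
    using span_reconstruction[OF B(1)] by blast
  ultimately show ?thesis using that by blast
qed

lemma linear_functional_continuous:
  assumes add: "\<And>s t. \<lbrakk>s \<in> W; t \<in> W\<rbrakk> \<Longrightarrow> F (s + t) = F s + F t"
    and scale: "\<And>c s. s \<in> W \<Longrightarrow> F (sscale c s) = c * (F s :: complex)"
  shows "continuous_on W F"
proof -
  obtain n :: nat and e a q where e: "\<And>j. j < n \<Longrightarrow> e j \<in> W"
    and rec: "\<And>s. s \<in> W \<Longrightarrow> (\<Sum>j<n. sscale (s (a j) (q j)) (e j)) = s"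
    using reconstruction by blast
  have F0: "F 0 = 0" using scale[OF W_0, of 0] by simp
  have sum: "F (\<Sum>j\<in>J. f j) = (\<Sum>j\<in>J. F (f j))" if "finite J" "\<And>j. j \<in> J \<Longrightarrow> f j \<in> W" for J :: "nat set" and f
    using that by (induction J rule: finite_induct) (auto simp: F0 add W_sum)
  have Feq: "F s = (\<Sum>j<n. s (a j) (q j) * F (e j))" if "s \<in> W" for s
  proof -
    have "F s = F (\<Sum>j<n. sscale (s (a j) (q j)) (e j))" using rec[OF that] by simp
    also have "\<dots> = (\<Sum>j<n. s (a j) (q j) * F (e j))"
      by (subst sum) (auto simp: W_scale e scale)
    finally show ?thesis .
  qed
  have ev: "continuous_on W (\<lambda>s. s i p)" for i p
    by (rule continuous_on_product_then_coordinatewise[OF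
          continuous_on_product_then_coordinatewise[OF continuous_on_id]])
  have "continuous_on W (\<lambda>s. \<Sum>j<n. s (a j) (q j) * F (e j))"
    by (intro continuous_intros ev)
  then show ?thesis by (rule continuous_on_eq) (simp add: Feq)
qed

lemma linear_map_continuous:
  fixes T :: "('p, 'i) bsection \<Rightarrow> ('p, 'i) bsection"
  assumes "\<And>s t. \<lbrakk>s \<in> W; t \<in> W\<rbrakk> \<Longrightarrow> T (s + t) = T s + T t"
    and "\<And>c s. s \<in> W \<Longrightarrow> T (sscale c s) = sscale c (T s)"
  shows "continuous_on W T"
  by (intro continuous_on_coordinatewise_then_product linear_functional_continuous)
    (simp_all add: assms sscale_apply)

text \<open>
  The Cauchy-Schwarz argument: otherwise the form would become negative on \<open>s - x c n\<close> for large \<open>x\<close>,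
  where \<open>c\<close> is the product of \<open>s\<close> and \<open>n\<close>.
\<close>

lemma radical:
  assumes n: "n \<in> W" "ip n n = 0" and s: "s \<in> W"
  shows "ip s n = 0"
proof (rule ccontr)
  define c where "c = ip s n"
  assume "ip s n \<noteq> 0"
  then have c: "0 < (cmod c)\<^sup>2" by (simp add: c_def)
  \<comment> \<open>This multiple makes the square of the difference equal to -1.\<close>
  define x where "x = (Re (ip s s) + 1) / (2 * (cmod c)\<^sup>2)"
  define t where "t = s - sscale (complex_of_real x * c) n"
  have "0 \<le> Re (ip t t)" by (rule ip_nonneg) (simp add: t_def ip_simps s n)
  have nc: "ip n s = cnj c" using ip_cnj[OF s n(1)] by (simp add: c_def)
  have "ip t t = ip s s - 2 * complex_of_real (x * (cmod c)\<^sup>2)"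
    using n s by (simp add: t_def ip_simps nc c_def[symmetric] complex_norm_square del: of_real_power)
  then have "Re (ip t t) = Re (ip s s) - 2 * x * (cmod c)\<^sup>2" by simp
  also have "\<dots> = - 1" using c by (simp add: x_def field_simps)
  finally show False using \<open>0 \<le> Re (ip t t)\<close> by simp
qed

definition unitary :: "(('p, 'i) bsection \<Rightarrow> ('p, 'i) bsection) \<Rightarrow> bool" where
  "unitary T \<longleftrightarrow> bij_betw T W W \<and>
     (\<forall>s\<in>W. \<forall>t\<in>W. T (s + t) = T s + T t) \<and>
     (\<forall>c. \<forall>s\<in>W. T (sscale c s) = sscale c (T s)) \<and>
     (\<forall>s\<in>W. \<forall>t\<in>W. ip (T s) (T t) = ip s t)"

definition usphere :: "('p, 'i) bsection set" where
  "usphere = {s \<in> W. sqrt (Re (ip s s)) = 1}"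

lemma usphere_ip: "s \<in> usphere \<longleftrightarrow> s \<in> W \<and> ip s s = 1"
  using ip_self[of s] by (auto simp: usphere_def complex_eq_iff)

end

locale haar_form = section_form W ip
  for W :: "('p, 'i) bsection set" and ip +
  fixes \<mu> :: "('p, 'i) bsection measure"
  assumes space_\<mu>: "space \<mu> = usphere"
    and sets_\<mu>: "sets \<mu> = sets (restrict_space borel usphere)"
    and total: "emeasure \<mu> (space \<mu>) = 1"
    and invariant: "unitary T \<Longrightarrow> distr \<mu> \<mu> T = \<mu>"
begin

sublocale finite_measure \<mu>
  by standard (simp add: total)

lemma measure_sphere: "measure \<mu> (space \<mu>) = 1"
  by (simp add: measure_def total)

lemma measurable_continuous:
  fixes F :: "('p, 'i) bsection \<Rightarrow> 'c::topological_space"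
  assumes "continuous_on W F"
  shows "F \<in> borel_measurable \<mu>"
proof -
  have "usphere \<subseteq> W" by (auto simp: usphere_def)
  then have "F \<in> borel_measurable (restrict_space borel usphere)"
    using assms by (intro borel_measurable_continuous_on_restrict) (rule continuous_on_subset)
  then show ?thesis using measurable_cong_sets[OF sets_\<mu> refl] by blast
qed

lemma measurable_linear:
  assumes "\<And>s t. \<lbrakk>s \<in> W; t \<in> W\<rbrakk> \<Longrightarrow> F (s + t) = F s + F t"
    and "\<And>c s. s \<in> W \<Longrightarrow> F (sscale c s) = c * (F s :: complex)"
  shows "F \<in> borel_measurable \<mu>"
  by (rule measurable_continuous[OF linear_functional_continuous[OF assms]])

lemma measurable_eval: "(\<lambda>s. s i p) \<in> borel_measurable \<mu>"
  by (rule measurable_linear) (auto simp: sscale_apply)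

lemma measurable_ip: "u \<in> W \<Longrightarrow> (\<lambda>s. ip s u) \<in> borel_measurable \<mu>"
  by (rule measurable_linear) (auto simp: ip_simps)

lemma integral_unitary:
  fixes F :: "('p, 'i) bsection \<Rightarrow> real"
  assumes T: "unitary T" and F: "F \<in> borel_measurable \<mu>"
  shows "(\<integral>s. F (T s) \<partial>\<mu>) = (\<integral>s. F s \<partial>\<mu>)"
proof -
  have Ts: "T s \<in> usphere" if "s \<in> usphere" for s
    using T that bij_betwE[of T W W] by (auto simp: unitary_def usphere_def)
  have "T \<in> borel_measurable \<mu>"
    using T by (intro measurable_continuous linear_map_continuous) (auto simp: unitary_def)
  then have "T \<in> measurable \<mu> (restrict_space borel usphere)"
    by (rule measurable_restrict_space2[rotated]) (auto simp: space_\<mu> Ts)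
  then have "T \<in> measurable \<mu> \<mu>" using measurable_cong_sets[OF refl sets_\<mu>] by blast
  then have "(\<integral>s. F s \<partial>distr \<mu> \<mu> T) = (\<integral>s. F (T s) \<partial>\<mu>)"
    by (rule integral_distr) (rule F)
  then show ?thesis using invariant[OF T] by simp
qed

text \<open>
  If \<open>n \<noteq> 0\<close> is in the radical, then \<open>s \<mapsto> s + c \<langle>s,u\<rangle> n\<close> is an isometry for every \<open>c\<close>. As \<open>c\<close> grows, it
  moves every \<open>s\<close> with \<open>\<langle>s,u\<rangle> \<noteq> 0\<close> to infinity, while the distribution of a coordinate at which \<open>n\<close> does not
  vanish stays the same. So almost every \<open>s\<close> is orthogonal to every \<open>u\<close>, in particular to itself, which
  is impossible on the unit sphere.
\<close>

lemma positive_definite: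
  assumes n: "n \<in> W" "ip n n = 0"
  shows "n = 0"
proof (rule ccontr)
  assume "n \<noteq> 0"
  then obtain i p where nz: "n i p \<noteq> 0" by (auto simp: fun_eq_iff)
  have rad: "ip s n = 0" "ip n s = 0" if "s \<in> W" for s
    using radical[OF n that] ip_cnj[OF that n(1)] by auto
  have ae: "AE s in \<mu>. ip s u = 0" if u: "u \<in> W" for u
  proof -
    define T where "T c s = s + sscale (of_nat c * ip s u) n" for c s
    have TW: "T c s \<in> W" if "s \<in> W" for c s
      using that n by (simp add: T_def ip_simps)
    have inv: "T c s - sscale (of_nat c * ip (T c s) u) n = s" if "s \<in> W" for c s
      using that n u by (simp add: T_def ip_simps rad)
    have "unitary (T c)" for c
      unfolding unitary_def
    proof (intro conjI ballI allI)
      show "bij_betw (T c) W W"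
      proof (rule bij_betw_byWitness[where f' = "\<lambda>s. s - sscale (of_nat c * ip s u) n"])
        show "\<forall>s\<in>W. T c (s - sscale (of_nat c * ip s u) n) = s"
          using n u by (simp add: T_def ip_simps rad)
      qed (use inv TW n in \<open>auto simp: ip_simps\<close>)
    qed (use n u in \<open>auto simp: T_def ip_simps rad fun_eq_iff sscale_apply algebra_simps\<close>)
    \<comment> \<open>A positive test function that tends to 0 when the coordinate tends to infinity.\<close>
    define \<phi> where "\<phi> s = inverse (1 + cmod (s i p))" for s :: "('p, 'i) bsection"
    define g where "g s = ip s u * n i p" for s
    have [measurable]: "\<phi> \<in> borel_measurable \<mu>" "(\<lambda>s. ip s u) \<in> borel_measurable \<mu>"
        "g \<in> borel_measurable \<mu>"
      unfolding \<phi>_def g_def using measurable_ip[OF u] measurable_eval by measurable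
    have [measurable]: "(\<lambda>s. \<phi> (T c s)) \<in> borel_measurable \<mu>" for c
      unfolding \<phi>_def T_def plus_fun_apply sscale_apply using measurable_eval by measurable
    have bd: "norm (\<phi> s) \<le> 1" for s
      unfolding \<phi>_def by (simp add: inverse_le_1_iff)
    have "(\<lambda>c. \<integral>s. \<phi> (T c s) \<partial>\<mu>) \<longlonglongrightarrow> (\<integral>s. (if g s = 0 then \<phi> s else 0) \<partial>\<mu>)"
    proof (rule integral_dominated_convergence[where w = "\<lambda>_. 1"])
      show "AE s in \<mu>. (\<lambda>c. \<phi> (T c s)) \<longlonglongrightarrow> (if g s = 0 then \<phi> s else 0)"
      proof (intro AE_I2)
        fix s
        have ev: "\<phi> (T c s) = inverse (1 + cmod (s i p + of_nat c * g s))" for c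
          by (simp add: \<phi>_def T_def g_def sscale_apply mult.assoc)
        show "(\<lambda>c. \<phi> (T c s)) \<longlonglongrightarrow> (if g s = 0 then \<phi> s else 0)"
        proof (cases "g s = 0")
          case True
          then show ?thesis unfolding ev by (simp add: \<phi>_def)
        next
          case False
          have lim0: "filterlim (\<lambda>c. - cmod (s i p) + cmod (g s) * real c) at_top sequentially"
            using False by (intro filterlim_tendsto_add_at_top[OF tendsto_const]
                filterlim_tendsto_pos_mult_at_top[OF tendsto_const] filterlim_real_sequentially) auto
          have le: "- cmod (s i p) + cmod (g s) * real c \<le> 1 + cmod (s i p + of_nat c * g s)" for c
            using norm_triangle_ineq2[of "of_nat c * g s" "- s i p"]
            by (simp add: norm_mult algebra_simps)
          have "filterlim (\<lambda>c. 1 + cmod (s i p + of_nat c * g s)) at_top sequentially"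
            by (rule filterlim_at_top_mono[OF lim0 always_eventually[OF allI[OF le]]])
          then show ?thesis unfolding ev using False by (simp add: tendsto_inverse_0_at_top)
        qed
      qed
    qed (use bd in auto)
    moreover have inv: "(\<integral>s. \<phi> (T c s) \<partial>\<mu>) = (\<integral>s. \<phi> s \<partial>\<mu>)" for c
      by (rule integral_unitary[OF \<open>unitary (T c)\<close>]) measurable
    ultimately have "(\<lambda>_::nat. \<integral>s. \<phi> s \<partial>\<mu>) \<longlonglongrightarrow> (\<integral>s. (if g s = 0 then \<phi> s else 0) \<partial>\<mu>)"
      by (simp only: inv)
    then have "(\<integral>s. \<phi> s \<partial>\<mu>) = (\<integral>s. (if g s = 0 then \<phi> s else 0) \<partial>\<mu>)"
      by (rule LIMSEQ_unique[OF tendsto_const])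
    moreover have i1: "integrable \<mu> \<phi>"
      by (rule integrable_const_bound[of _ 1]) (use bd in auto)
    moreover have i2: "integrable \<mu> (\<lambda>s. if g s = 0 then \<phi> s else 0)"
      by (rule integrable_const_bound[of _ 1]) (use bd in auto)
    ultimately have "(\<integral>s. \<phi> s - (if g s = 0 then \<phi> s else 0) \<partial>\<mu>) = 0" by simp
    moreover have "0 \<le> \<phi> s" for s by (simp add: \<phi>_def)
    ultimately have "AE s in \<mu>. \<phi> s - (if g s = 0 then \<phi> s else 0) = 0"
      by (subst (asm) integral_nonneg_eq_0_iff_AE) (use i1 i2 in auto)
    moreover have "\<phi> s \<noteq> 0" for s
      unfolding \<phi>_def using norm_ge_zero[of "s i p"] by (simp add: add_nonneg_eq_0_iff)
    ultimately show ?thesis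
      by (elim AE_mp) (use nz in \<open>auto simp: g_def intro!: AE_I2 split: if_splits\<close>)
  qed
  obtain n :: nat and e a q where e: "\<And>j. j < n \<Longrightarrow> e j \<in> W"
    and rec: "\<And>s. s \<in> W \<Longrightarrow> (\<Sum>j<n. sscale (s (a j) (q j)) (e j)) = s"
    using reconstruction by blast
  have "AE s in \<mu>. \<forall>j\<in>{..<n}. ip s (e j) = 0"
    using ae e by (subst AE_finite_all) auto
  moreover have "False" if "s \<in> space \<mu>" "\<forall>j\<in>{..<n}. ip s (e j) = 0" for s
  proof -
    have s: "s \<in> W" "ip s s = 1" using that by (auto simp: space_\<mu> usphere_ip)
    have "ip s s = ip s (\<Sum>j<n. sscale (s (a j) (q j)) (e j))" using rec[OF s(1)] by simp
    also have "\<dots> = 0" 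
      by (subst ip_sum_right) (use that(2) s e in \<open>auto simp: ip_simps\<close>)
    finally show False using s by simp
  qed
  ultimately have "AE s in \<mu>. False" by (elim AE_mp) (intro AE_I2 impI, assumption)
  then have "emeasure \<mu> (space \<mu>) = 0" by (subst (asm) AE_iff_measurable[OF sets.top]) auto
  then show False using total by simp
qed

end

section \<open>Powers of a quadratic polynomial\<close>

lemma coeff_quadratic_mult:
  "coeff ([:a, q, b:] * p) l =
     a * coeff p l + (if l = 0 then 0 else q * coeff p (l - 1)) + (if l < 2 then 0 else b * coeff p (l - 2))"
  for a q b :: real
  by (auto simp: mult_pCons_left coeff_pCons split: nat.splits)

lemma coeff_quadratic_power_le:
  fixes a q b :: real
  assumes "\<bar>a\<bar> \<le> 1" "\<bar>q\<bar> \<le> 2" "\<bar>b\<bar> \<le> 1"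
  shows "\<bar>coeff ([:a, q, b:] ^ n) l\<bar> \<le> 4 ^ n"
proof (induction n arbitrary: l)
  case 0
  then show ?case by (simp add: coeff_1)
next
  case (Suc n)
  have 1: "\<bar>a * coeff ([:a, q, b:] ^ n) l\<bar> \<le> 1 * 4 ^ n"
    unfolding abs_mult by (intro mult_mono Suc.IH assms) auto
  have 2: "\<bar>if l = 0 then 0 else q * coeff ([:a, q, b:] ^ n) (l - 1)\<bar> \<le> 2 * 4 ^ n"
    using mult_mono[OF assms(2) Suc.IH[of "l - 1"]] by (simp add: abs_mult)
  have 3: "\<bar>if l < 2 then 0 else b * coeff ([:a, q, b:] ^ n) (l - 2)\<bar> \<le> 1 * 4 ^ n"
    using mult_mono[OF assms(3) Suc.IH[of "l - 2"]] by (simp add: abs_mult)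
  have "\<bar>coeff ([:a, q, b:] ^ Suc n) l\<bar> \<le> 1 * 4 ^ n + 2 * 4 ^ n + 1 * 4 ^ n"
    unfolding power_Suc coeff_quadratic_mult
    using 1 2 3 by linarith
  then show ?case by simp
qed

text \<open>
  The coefficient of \<open>t\<^sup>2\<close> in \<open>(a + q t + b t\<^sup>2)\<^sup>N\<close> is \<open>N a\<^sup>N\<^sup>-\<^sup>1 b\<close> plus \<open>N (N-1)/2\<close> times \<open>a\<^sup>N\<^sup>-\<^sup>2 q\<^sup>2\<close>; the hypothesis
  on \<open>q\<close> absorbs the second term into the first. Here \<open>N = n + 1\<close>.
\<close>

lemma coeff_quadratic_power_2_le:
  fixes a q b :: real
  assumes "0 \<le> a" "0 \<le> b" "q\<^sup>2 \<le> 4 * a * b"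
  shows "coeff ([:a, q, b:] ^ Suc n) 2 \<le> (real n + 1) * (2 * real n + 1) * (a ^ n * b)"
proof -
  have c0: "coeff ([:a, q, b:] ^ n) 0 = a ^ n" for n
    by (induction n) (simp_all only: power_Suc coeff_quadratic_mult, simp_all)
  have c1: "coeff ([:a, q, b:] ^ Suc n) 1 = (real n + 1) * q * a ^ n" for n
  proof (induction n)
    case 0
    show ?case by simp
  next
    case (Suc n)
    show ?case
      unfolding power_Suc[of _ "Suc n"] coeff_quadratic_mult Suc.IH
      using c0[of "Suc n"] by (simp add: algebra_simps del: power_Suc) (simp add: algebra_simps)
  qed
  show ?thesis
  proof (induction n)
    case 0
    show ?case by (simp add: numeral_2_eq_2)
  next
    case (Suc n)
    have eq: "coeff ([:a, q, b:] ^ Suc (Suc n)) 2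
        = a * coeff ([:a, q, b:] ^ Suc n) 2 + q * ((real n + 1) * q * a ^ n) + b * a ^ Suc n"
      unfolding power_Suc[of _ "Suc n"] coeff_quadratic_mult
      using c0[of "Suc n"] c1[of n] by (simp del: power_Suc)
    have "q * ((real n + 1) * q * a ^ n) = ((real n + 1) * a ^ n) * q\<^sup>2"
      by (simp add: power2_eq_square algebra_simps)
    also have "\<dots> \<le> ((real n + 1) * a ^ n) * (4 * a * b)"
      using assms by (intro mult_left_mono) auto
    finally have "coeff ([:a, q, b:] ^ Suc (Suc n)) 2
        \<le> a * ((real n + 1) * (2 * real n + 1) * (a ^ n * b)) + ((real n + 1) * a ^ n) * (4 * a * b) + b * a ^ Suc n"
      unfolding eq using mult_left_mono[OF Suc.IH assms(1)] by linarith
    then show ?case by (simp add: algebra_simps)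
  qed
qed

lemma coeff_one_plus_square_power: "coeff ([:1, 0, 1:] ^ n) 2 = real n"
proof (induction n)
  case (Suc n)
  have "coeff ([:1, 0, 1:] ^ n) 0 = (1::real)"
    by (induction n) (simp_all only: power_Suc coeff_quadratic_mult, simp_all)
  then show ?case unfolding power_Suc coeff_quadratic_mult Suc.IH by simp
qed (simp add: coeff_1)

lemma poly_eq_sum_atMost:
  "degree p \<le> N \<Longrightarrow> poly p x = (\<Sum>l\<le>N. coeff p l * x ^ l)" for x :: real
  unfolding poly_altdef by (rule sum.mono_neutral_left) (auto simp: coeff_eq_0)

section \<open>Orthonormal bases and moments on the unit sphere\<close>

context haar_form
begin

definition orthonormal_set :: "('p, 'i) bsection set \<Rightarrow> bool" where
  "orthonormal_set B \<longleftrightarrow> finite B \<and> B \<subseteq> W \<and> (\<forall>s\<in>B. \<forall>t\<in>B. ip s t = (if s = t then 1 else 0))"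

lemma ip_sum_orthonormal:
  assumes B: "orthonormal_set B" and b: "b \<in> B"
  shows "ip (\<Sum>x\<in>B. sscale (c x) x) b = c b"
proof -
  have "ip (\<Sum>x\<in>B. sscale (c x) x) b = (\<Sum>x\<in>B. ip (sscale (c x) x) b)"
    using B b by (intro ip_sum) (auto simp: orthonormal_set_def intro: W_scale)
  also have "\<dots> = (\<Sum>x\<in>B. if x = b then c x else 0)"
    using B b by (intro sum.cong) (auto simp: orthonormal_set_def ip_scale subset_iff)
  also have "\<dots> = c b"
    using B b by (simp add: orthonormal_set_def)
  finally show ?thesis .
qed

lemma ip_pos: "\<lbrakk>s \<in> W; s \<noteq> 0\<rbrakk> \<Longrightarrow> 0 < Re (ip s s)"
  using ip_nonneg[of s] positive_definite[of s] ip_self[of s] by (cases "Re (ip s s) = 0") auto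

lemma gram_schmidt:
  assumes "finite A" "A \<subseteq> W"
  shows "\<exists>B. orthonormal_set B \<and> A \<subseteq> sec.span B"
  using assms
proof induction
  case empty
  show ?case by (rule exI[of _ "{}"]) (simp add: orthonormal_set_def)
next
  case (insert a A)
  then obtain B where B: "orthonormal_set B" "A \<subseteq> sec.span B" by blast
  have a: "a \<in> W" using insert by simp
  define p where "p = (\<Sum>x\<in>B. sscale (ip a x) x)"
  have pW: "p \<in> W"
    using B unfolding p_def by (intro W_sum) (auto simp: orthonormal_set_def intro: W_scale)
  have psp: "p \<in> sec.span B'" if "B \<subseteq> B'" for B'
    unfolding p_def using that by (intro sec.span_sum sec.span_scale sec.span_base) auto
  define r where "r = a - p"
  have rW: "r \<in> W" using a pW by (simp add: r_def W_diff)
  have rb: "ip r b = 0" "ip b r = 0" if "b \<in> B" for b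
  proof -
    have bW: "b \<in> W" using that B by (auto simp: orthonormal_set_def)
    show "ip r b = 0"
      using a pW bW ip_sum_orthonormal[OF B(1) that, of "ip a"] by (simp add: r_def ip_simps p_def)
    then show "ip b r = 0" using ip_cnj[OF rW bW] by simp
  qed
  show ?case
  proof (cases "r = 0")
    case True
    then have "a = p" by (simp add: r_def)
    then show ?thesis using B psp[of B] by auto
  next
    case False
    define N where "N = Re (ip r r)"
    have N: "ip r r = complex_of_real N" using ip_self[OF rW] by (simp add: N_def)
    have N0: "N > 0" unfolding N_def by (rule ip_pos[OF rW False])
    define g where "g = sscale (complex_of_real (1 / sqrt N)) r"
    have gW: "g \<in> W" using rW by (simp add: g_def W_scale)
    have "complex_of_real (sqrt N) * complex_of_real (sqrt N) = complex_of_real N"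
      using N0 by (simp flip: of_real_mult)
    then have gg: "ip g g = 1"
      using rW N0 by (simp add: g_def ip_simps N field_simps)
    have gb: "ip g b = 0" "ip b g = 0" if "b \<in> B" for b
      using rb[OF that] rW that B by (auto simp: g_def ip_simps orthonormal_set_def subset_iff)
    have "orthonormal_set (insert g B)"
      using B gW gg gb unfolding orthonormal_set_def by auto
    moreover have "a \<in> sec.span (insert g B)"
    proof -
      have "a = p + sscale (complex_of_real (sqrt N)) g"
        using N0 by (auto simp: g_def r_def fun_eq_iff sscale_apply)
      also have "\<dots> \<in> sec.span (insert g B)"
        by (intro sec.span_add psp sec.span_scale sec.span_base) auto
      finally show ?thesis .
    qed
    moreover have "A \<subseteq> sec.span (insert g B)"
      using B(2) sec.span_mono[of B "insert g B"] by blast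
    ultimately show ?thesis by blast
  qed
qed

lemma onb_exists: "\<exists>B. orthonormal_set B \<and> W \<subseteq> sec.span B"
proof -
  obtain A where A: "finite A" "A \<subseteq> W" "W \<subseteq> sec.span A" using finite_dim by blast
  obtain B where B: "orthonormal_set B" "A \<subseteq> sec.span B" using gram_schmidt[OF A(1,2)] by blast
  have "sec.span A \<subseteq> sec.span B" using sec.span_minimal[OF B(2) sec.subspace_span] .
  then show ?thesis using A B by blast
qed

lemma onb_expand:
  assumes B: "orthonormal_set B" "W \<subseteq> sec.span B" and s: "s \<in> W"
  shows "s = (\<Sum>b\<in>B. sscale (ip s b) b)"
proof -
  have "finite B" using B by (simp add: orthonormal_set_def)
  then obtain c where c: "s = (\<Sum>b\<in>B. sscale (c b) b)"
    using B(2) s sec.span_finite[of B] by blast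
  show ?thesis
    unfolding c by (intro sum.cong refl) (simp only: ip_sum_orthonormal[OF B(1)])
qed

lemma card_onb:
  assumes B: "orthonormal_set B" "W \<subseteq> sec.span B"
  shows "card B = sec.dim W"
proof -
  have fin: "finite B" using B by (simp add: orthonormal_set_def)
  have W0: "ip 0 b = 0" if "b \<in> B" for b using that B by (auto simp: orthonormal_set_def ip_zero)
  have "sec.independent B"
  proof
    assume "sec.dependent B"
    then obtain c v where v: "v \<in> B" "c v \<noteq> 0" "(\<Sum>b\<in>B. sscale (c b) b) = 0"
      using sec.dependent_finite[OF fin] by blast
    then show False using ip_sum_orthonormal[OF B(1) v(1), of c] W0[OF v(1)] by simp
  qed
  then show ?thesis
    using B sec.basis_card_eq_dim[of B W] by (simp add: orthonormal_set_def)
qed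

lemma parseval:
  assumes B: "orthonormal_set B" "W \<subseteq> sec.span B" and s: "s \<in> usphere"
  shows "(\<Sum>b\<in>B. (cmod (ip s b))\<^sup>2) = 1"
proof -
  have sW: "s \<in> W" and s1: "ip s s = 1" using s by (auto simp: usphere_ip)
  have "ip s s = ip s (\<Sum>b\<in>B. sscale (ip s b) b)" using onb_expand[OF B sW] by simp
  also have "\<dots> = (\<Sum>b\<in>B. ip s (sscale (ip s b) b))"
    using B sW by (intro ip_sum_right) (auto simp: orthonormal_set_def intro: W_scale)
  also have "\<dots> = (\<Sum>b\<in>B. complex_of_real ((cmod (ip s b))\<^sup>2))"
    using B sW by (intro sum.cong)
      (auto simp: orthonormal_set_def ip_scale_right subset_iff complex_norm_square mult.commute
         simp del: of_real_power)
  finally show ?thesis using s1 by (metis of_real_eq_1_iff of_real_sum)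
qed

lemma bessel:
  assumes v: "v \<in> W" "ip v v = 1" and s: "s \<in> usphere"
  shows "cmod (ip s v) \<le> 1"
proof -
  have sW: "s \<in> W" and s1: "ip s s = 1" using s by (auto simp: usphere_ip)
  have vs: "ip v s = cnj (ip s v)" by (rule ip_cnj[OF sW v(1)])
  have "0 \<le> Re (ip (s - sscale (ip s v) v) (s - sscale (ip s v) v))"
    by (rule ip_nonneg) (simp add: ip_simps v sW)
  also have "ip (s - sscale (ip s v) v) (s - sscale (ip s v) v) = 1 - complex_of_real ((cmod (ip s v))\<^sup>2)"
    using v sW s1 by (simp add: ip_simps vs complex_norm_square algebra_simps del: of_real_power)
  finally have "(cmod (ip s v))\<^sup>2 \<le> 1\<^sup>2" by simp
  then show ?thesis by (rule power2_le_imp_le) simp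
qed

text \<open>
  The unitary map is the reflection in the hyperplane orthogonal to \<open>u - v\<close>. It exchanges \<open>u\<close> and \<open>v\<close>
  when their product is real, which can always be achieved by a phase.
\<close>

lemma householder:
  assumes u: "u \<in> W" "ip u u = 1" and v: "v \<in> W" "ip v v = 1" and real: "Im (ip u v) = 0"
  shows "\<exists>T. unitary T \<and> (\<forall>s\<in>W. ip (T s) u = ip s v)"
proof (cases "u = v")
  case True
  have "unitary (\<lambda>s. s)" by (simp add: unitary_def bij_betw_def)
  then show ?thesis using True by blast
next
  case False
  define w where "w = u - v"
  have wW: "w \<in> W" using u v by (simp add: w_def W_diff)
  define N where "N = ip w w"
  have N0: "N \<noteq> 0" using positive_definite[OF wW] False by (auto simp: N_def w_def)
  have cN: "cnj N = N" unfolding N_def using ip_cnj[OF wW wW] by simp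
  have vu: "ip v u = ip u v" using ip_cnj[OF u(1) v(1)] real by (simp add: complex_eq_iff)
  have wu: "ip w u = N / 2"
    using u v vu by (simp add: N_def w_def ip_simps)
  define T where "T s = s - sscale (2 * ip s w / N) w" for s
  have TW: "T s \<in> W" if "s \<in> W" for s using that wW by (simp add: T_def ip_simps)
  have Tw: "ip (T s) w = - ip s w" if "s \<in> W" for s
    using that wW N0 by (simp add: T_def ip_simps N_def[symmetric])
  have TT: "T (T s) = s" if "s \<in> W" for s
    using Tw[OF that] unfolding T_def[of "T s"] by (simp add: T_def fun_eq_iff sscale_apply)
  have iso: "ip (T s) (T t) = ip s t" if "s \<in> W" "t \<in> W" for s t
  proof -
    have wt: "ip w t = cnj (ip t w)" by (rule ip_cnj[OF that(2) wW])
    show ?thesis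
      using that wW N0 cN
      by (simp add: T_def ip_simps wt N_def[symmetric] field_simps)
  qed
  have "unitary T"
    unfolding unitary_def
  proof (intro conjI ballI allI)
    show "bij_betw T W W"
      by (rule bij_betw_byWitness[where f' = T]) (use TW TT in auto)
  next
    show "T (s + t) = T s + T t" if "s \<in> W" "t \<in> W" for s t
      unfolding T_def ip_add[OF that wW]
      by (simp add: fun_eq_iff sscale_apply add_divide_distrib algebra_simps)
    show "T (sscale c s) = sscale c (T s)" if "s \<in> W" for c s
      unfolding T_def ip_scale[OF that wW]
      by (simp add: fun_eq_iff sscale_apply algebra_simps)
  qed (rule iso)
  moreover have "ip (T s) u = ip s v" if "s \<in> W" for s
    using that u wW N0 v by (simp add: T_def ip_simps wu) (simp add: w_def ip_simps u v)
  ultimately show ?thesis by blast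
qed

lemma integrable_bounded:
  fixes F :: "('p, 'i) bsection \<Rightarrow> real"
  assumes "F \<in> borel_measurable \<mu>" "\<And>s. s \<in> usphere \<Longrightarrow> \<bar>F s\<bar> \<le> C"
  shows "integrable \<mu> F"
  by (rule integrable_const_bound[of _ C]) (use assms in \<open>auto simp: space_\<mu>\<close>)

lemma integral_ip_unit:
  assumes u: "u \<in> W" "ip u u = 1" and v: "v \<in> W" "ip v v = 1"
  shows "(\<integral>s. cmod (ip s u) ^ n \<partial>\<mu>) = (\<integral>s. cmod (ip s v) ^ n \<partial>\<mu>)"
proof -
  \<comment> \<open>This phase makes the product of u and c v real, as the reflection requires.\<close>
  define c where "c = (if ip u v = 0 then 1 else sgn (ip u v))"
  have c1: "cmod c = 1" by (simp add: c_def norm_sgn)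
  then have cc: "c * cnj c = 1" by (simp add: complex_norm_square[symmetric])
  define v' where "v' = sscale c v"
  have v': "v' \<in> W" "ip v' v' = 1"
    using v cc by (simp_all add: v'_def ip_simps mult.commute)
  have "ip u v' = complex_of_real (cmod (ip u v))"
  proof (cases "ip u v = 0")
    case False
    have "cnj (ip u v) * ip u v = complex_of_real (cmod (ip u v)) * complex_of_real (cmod (ip u v))"
      using complex_norm_square[of "ip u v"] by (simp add: power2_eq_square mult.commute)
    then show ?thesis
      using u v False by (simp add: v'_def ip_simps c_def sgn_eq)
  qed (use u v in \<open>simp add: v'_def ip_simps\<close>)
  then have "Im (ip u v') = 0" by simp
  from householder[OF u v' this] obtain T
    where T: "unitary T" "\<And>s. s \<in> W \<Longrightarrow> ip (T s) u = ip s v'" by blast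
  have [measurable]: "(\<lambda>s. ip s u) \<in> borel_measurable \<mu>" by (rule measurable_ip[OF u(1)])
  have "(\<integral>s. cmod (ip s u) ^ n \<partial>\<mu>) = (\<integral>s. cmod (ip (T s) u) ^ n \<partial>\<mu>)"
    by (rule integral_unitary[OF T(1), symmetric]) measurable
  also have "\<dots> = (\<integral>s. cmod (ip s v) ^ n \<partial>\<mu>)"
    by (rule Bochner_Integration.integral_cong)
      (auto simp: space_\<mu> usphere_def T v'_def ip_scale_right v norm_mult c1)
  finally show ?thesis .
qed

lemma moment_scale:
  assumes u: "u \<in> W" and v: "v \<in> W" "ip v v = 1"
  shows "(\<integral>s. cmod (ip s u) ^ (2 * n) \<partial>\<mu>) = Re (ip u u) ^ n * (\<integral>s. cmod (ip s v) ^ (2 * n) \<partial>\<mu>)"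
proof (cases "u = 0")
  case True
  have "(\<integral>s. cmod (ip s u) ^ (2 * n) \<partial>\<mu>) = (\<integral>s. 0 ^ (2 * n) \<partial>\<mu>)"
    by (rule Bochner_Integration.integral_cong) (auto simp: True space_\<mu> usphere_def ip_zero)
  then show ?thesis using True W_0 by (cases "n = 0") (auto simp: ip_zero power_0_left)
next
  case False
  define N where "N = Re (ip u u)"
  have N: "ip u u = complex_of_real N" using ip_self[OF u] by (simp add: N_def)
  have N0: "N > 0" unfolding N_def by (rule ip_pos[OF u False])
  define g where "g = sscale (complex_of_real (1 / sqrt N)) u"
  have sq: "complex_of_real (sqrt N) * complex_of_real (sqrt N) = complex_of_real N"
    using N0 by (simp flip: of_real_mult)
  have g: "g \<in> W" "ip g g = 1"
    using u N0 sq by (simp_all add: g_def ip_simps N field_simps)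
  have "(\<integral>s. cmod (ip s u) ^ (2 * n) \<partial>\<mu>) = (\<integral>s. N ^ n * cmod (ip s g) ^ (2 * n) \<partial>\<mu>)"
  proof (rule Bochner_Integration.integral_cong[OF refl])
    fix s assume "s \<in> space \<mu>"
    then have "s \<in> W" by (simp add: space_\<mu> usphere_def)
    then have "cmod (ip s g) = cmod (ip s u) / sqrt N"
      using u N0 by (simp add: g_def ip_simps norm_divide)
    then have "(cmod (ip s u))\<^sup>2 = N * (cmod (ip s g))\<^sup>2"
      using N0 by (simp add: power_divide)
    then show "cmod (ip s u) ^ (2 * n) = N ^ n * cmod (ip s g) ^ (2 * n)"
      by (simp add: power_mult power_mult_distrib)
  qed
  also have "\<dots> = N ^ n * (\<integral>s. cmod (ip s g) ^ (2 * n) \<partial>\<mu>)" by simp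
  also have "(\<integral>s. cmod (ip s g) ^ (2 * n) \<partial>\<mu>) = (\<integral>s. cmod (ip s v) ^ (2 * n) \<partial>\<mu>)"
    by (rule integral_ip_unit[OF g v])
  finally show ?thesis by (simp add: N_def)
qed

text \<open>
  By invariance the mean of \<open>|\<langle>s,e\<rangle> + t \<langle>s,f\<rangle>|\<close> to the power \<open>2n\<close>, a polynomial in \<open>t\<close>, is
  \<open>(1 + t\<^sup>2)\<^sup>n\<close> times its value at \<open>t = 0\<close>. The inequality compares the coefficients of \<open>t\<^sup>2\<close>, with
  \<open>n = m + 1\<close>.
\<close>

lemma mixed_moment:
  assumes e: "e \<in> W" "ip e e = 1" and f: "f \<in> W" "ip f f = 1" and ef: "ip e f = 0"
  shows "(\<integral>s. cmod (ip s e) ^ (2 * Suc m) \<partial>\<mu>)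
     \<le> (2 * real m + 1) * (\<integral>s. cmod (ip s e) ^ (2 * m) * (cmod (ip s f))\<^sup>2 \<partial>\<mu>)"
proof -
  define n where "n = Suc m"
  have n1: "1 \<le> n" and rn: "real n = real m + 1" by (simp_all add: n_def)
  define M where "M = (\<integral>s. cmod (ip s e) ^ (2 * n) \<partial>\<mu>)"
  define a where "a s = (cmod (ip s e))\<^sup>2" for s
  define b where "b s = (cmod (ip s f))\<^sup>2" for s
  define q where "q s = 2 * Re (ip s e * cnj (ip s f))" for s
  have [measurable]: "(\<lambda>s. ip s e) \<in> borel_measurable \<mu>" "(\<lambda>s. ip s f) \<in> borel_measurable \<mu>"
    using measurable_ip e f by auto
  have [measurable]: "a \<in> borel_measurable \<mu>" "b \<in> borel_measurable \<mu>" "q \<in> borel_measurable \<mu>"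
    unfolding a_def b_def q_def times_complex.sel cnj.sel by measurable
  define c where "c n l s = coeff ([:a s, q s, b s:] ^ n) l" for n l s
  have a01: "0 \<le> a s" "a s \<le> 1" "0 \<le> b s" "b s \<le> 1" if "s \<in> usphere" for s
    using bessel[OF e that] bessel[OF f that] by (auto simp: a_def b_def power_le_one)
  have qab: "(q s)\<^sup>2 \<le> 4 * a s * b s" for s
  proof -
    have "\<bar>Re (ip s e * cnj (ip s f))\<bar> \<le> cmod (ip s e) * cmod (ip s f)"
      using abs_Re_le_cmod[of "ip s e * cnj (ip s f)"] by (simp add: norm_mult)
    then have "(Re (ip s e * cnj (ip s f)))\<^sup>2 \<le> (cmod (ip s e) * cmod (ip s f))\<^sup>2"
      by (metis abs_ge_zero power2_abs power_mono)
    then show ?thesis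
      by (simp add: q_def a_def b_def power_mult_distrib del: times_complex.sel)
  qed
  have q2: "\<bar>q s\<bar> \<le> 2" if "s \<in> usphere" for s
  proof -
    have "a s * b s \<le> 1 * 1" using a01[OF that] by (intro mult_mono) auto
    then have "\<bar>q s\<bar>\<^sup>2 \<le> 2\<^sup>2" using qab[of s] by simp
    then show ?thesis by (rule power2_le_imp_le) simp
  qed
  have c_meas [measurable]: "c n l \<in> borel_measurable \<mu>" for n l
  proof (induction n arbitrary: l)
    case 0
    then show ?case by (simp add: c_def)
  next
    case (Suc n)
    note [measurable] = Suc.IH
    have "c (Suc n) l = (\<lambda>s. a s * c n l s + (if l = 0 then 0 else q s * c n (l - 1) s)
        + (if l < 2 then 0 else b s * c n (l - 2) s))"
      by (rule ext) (simp only: c_def power_Suc coeff_quadratic_mult)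
    then show ?case by simp
  qed
  have c_int: "integrable \<mu> (c n l)" for n l
    by (rule integrable_bounded[OF c_meas, of _ _ "4 ^ n"])
      (unfold c_def, rule coeff_quadratic_power_le, use a01 q2 in auto)
  have expand: "cmod (ip s (e + sscale (complex_of_real t) f)) ^ (2 * n) = (\<Sum>l\<le>2 * n. c n l s * t ^ l)"
    if "s \<in> usphere" for s t
  proof -
    have sW: "s \<in> W" using that by (simp add: usphere_def)
    have "(cmod (ip s (e + sscale (complex_of_real t) f)))\<^sup>2 = (cmod (ip s e + t * ip s f))\<^sup>2"
      using sW e f by (simp add: ip_simps)
    also have "\<dots> = a s + q s * t + b s * t\<^sup>2"
      by (simp add: a_def b_def q_def cmod_power2) (simp add: algebra_simps power2_eq_square)
    also have "\<dots> = poly [:a s, q s, b s:] t" by (simp add: algebra_simps power2_eq_square)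
    finally have "cmod (ip s (e + sscale (complex_of_real t) f)) ^ (2 * n) = poly ([:a s, q s, b s:] ^ n) t"
      by (simp add: power_mult)
    also have "\<dots> = (\<Sum>l\<le>2 * n. c n l s * t ^ l)"
    proof -
      have "degree [:a s, q s, b s:] * n \<le> 2 * n" by (intro mult_right_mono) (auto simp: degree_pCons_eq_if)
      then have "degree ([:a s, q s, b s:] ^ n) \<le> 2 * n"
        using degree_power_le[of "[:a s, q s, b s:]" n] by linarith
      then show ?thesis unfolding c_def by (rule poly_eq_sum_atMost)
    qed
    finally show ?thesis .
  qed
  \<comment> \<open>The polynomial in t whose values are the means of the powers for all t.\<close>
  define Q where "Q = (\<Sum>l\<le>2 * n. monom (\<integral>s. c n l s \<partial>\<mu>) l)"
  have "poly Q t = poly (smult M ([:1, 0, 1:] ^ n)) t" for t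
  proof -
    define u where "u = e + sscale (complex_of_real t) f"
    have uW: "u \<in> W" using e f by (simp add: u_def ip_simps)
    have fe: "ip f e = 0" using ip_cnj[OF e(1) f(1)] ef by simp
    have "ip u u = 1 + complex_of_real (t\<^sup>2)"
      using e f ef fe by (simp add: u_def ip_simps power2_eq_square)
    then have "Re (ip u u) = 1 + t\<^sup>2" by simp
    then have "(1 + t\<^sup>2) ^ n * M = (\<integral>s. cmod (ip s u) ^ (2 * n) \<partial>\<mu>)"
      unfolding M_def using moment_scale[OF uW e] by simp
    also have "\<dots> = (\<integral>s. (\<Sum>l\<le>2 * n. c n l s * t ^ l) \<partial>\<mu>)"
      by (rule Bochner_Integration.integral_cong) (simp_all add: u_def expand space_\<mu>)
    also have "\<dots> = (\<Sum>l\<le>2 * n. (\<integral>s. c n l s \<partial>\<mu>) * t ^ l)"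
      by (subst Bochner_Integration.integral_sum) (auto intro: c_int)
    also have "\<dots> = poly Q t" by (simp add: Q_def poly_sum poly_monom)
    finally show ?thesis by (simp add: power2_eq_square mult.commute add.commute)
  qed
  then have "Q = smult M ([:1, 0, 1:] ^ n)" by (simp add: poly_eq_poly_eq_iff[symmetric] fun_eq_iff)
  then have "coeff Q 2 = M * real n" by (simp add: coeff_one_plus_square_power)
  moreover have "coeff Q 2 = (\<integral>s. c n 2 s \<partial>\<mu>)"
    using n1 by (simp add: Q_def coeff_sum)
  ultimately have "real n * M = (\<integral>s. c n 2 s \<partial>\<mu>)" by simp
  also have "\<dots> \<le> (\<integral>s. real n * (2 * real m + 1) * (a s ^ m * b s) \<partial>\<mu>)"
  proof (rule integral_mono[OF c_int])
    have "\<bar>a s ^ m * b s\<bar> \<le> 1" if "s \<in> usphere" for s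
      using a01[OF that] by (simp add: abs_mult mult_le_one power_le_one)
    then have "integrable \<mu> (\<lambda>s. a s ^ m * b s)"
      by (intro integrable_bounded[of _ 1]) auto
    then show "integrable \<mu> (\<lambda>s. real n * (2 * real m + 1) * (a s ^ m * b s))"
      by (rule integrable_mult_right)
    fix s assume "s \<in> space \<mu>"
    then have "s \<in> usphere" by (simp add: space_\<mu>)
    then show "c n 2 s \<le> real n * (2 * real m + 1) * (a s ^ m * b s)"
      using coeff_quadratic_power_2_le[of "a s" "b s" "q s" m, folded n_def] a01 qab
      by (simp add: c_def rn)
  qed
  also have "\<dots> = real n * ((2 * real m + 1) * (\<integral>s. a s ^ m * b s \<partial>\<mu>))"
    by simp
  finally have "M \<le> (2 * real m + 1) * (\<integral>s. a s ^ m * b s \<partial>\<mu>)"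
    using mult_le_cancel_left_pos[of "real n"] by (simp add: n_def)
  then show ?thesis by (simp add: M_def n_def a_def b_def power_mult)
qed

text \<open>
  On the unit sphere the squares of the coordinates sum to 1. Multiplying by a power of one coordinate
  and taking means expresses the lower moment by the next one and the mixed moments, which
  are bounded below by \<open>mixed_moment\<close>.
\<close>

lemma moment_recursion:
  assumes B: "orthonormal_set B" "W \<subseteq> sec.span B" and e: "e \<in> B"
  shows "real (card B) * (\<integral>s. cmod (ip s e) ^ (2 * Suc m) \<partial>\<mu>)
     \<le> 2 * real (Suc m) * (\<integral>s. cmod (ip s e) ^ (2 * m) \<partial>\<mu>)"
proof -
  define M where "M n = (\<integral>s. cmod (ip s e) ^ (2 * n) \<partial>\<mu>)" for n
  have fin: "finite B" and BW: "B \<subseteq> W" and on: "\<And>s t. \<lbrakk>s \<in> B; t \<in> B\<rbrakk> \<Longrightarrow> ip s t = (if s = t then 1 else 0)"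
    using B by (auto simp: orthonormal_set_def)
  have int: "integrable \<mu> (\<lambda>s. cmod (ip s e) ^ (2 * m) * (cmod (ip s b))\<^sup>2)" if "b \<in> B" for b
  proof (rule integrable_bounded[of _ 1])
    have [measurable]: "(\<lambda>s. ip s e) \<in> borel_measurable \<mu>" "(\<lambda>s. ip s b) \<in> borel_measurable \<mu>"
      using measurable_ip e that BW by auto
    show "(\<lambda>s. cmod (ip s e) ^ (2 * m) * (cmod (ip s b))\<^sup>2) \<in> borel_measurable \<mu>" by measurable
    fix s assume "s \<in> usphere"
    then have "cmod (ip s e) \<le> 1" "cmod (ip s b) \<le> 1"
      using bessel[of _ s] on e that BW by (auto simp: subset_iff)
    then show "\<bar>cmod (ip s e) ^ (2 * m) * (cmod (ip s b))\<^sup>2\<bar> \<le> 1"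
      by (simp add: abs_mult mult_le_one power_le_one)
  qed
  have M0: "0 \<le> M n" for n by (simp add: M_def)
  have "M m = (\<integral>s. (\<Sum>b\<in>B. cmod (ip s e) ^ (2 * m) * (cmod (ip s b))\<^sup>2) \<partial>\<mu>)"
    unfolding M_def
    by (rule Bochner_Integration.integral_cong) (simp_all add: space_\<mu> parseval[OF B] flip: sum_distrib_left)
  also have "\<dots> = (\<Sum>b\<in>B. \<integral>s. cmod (ip s e) ^ (2 * m) * (cmod (ip s b))\<^sup>2 \<partial>\<mu>)"
    by (rule Bochner_Integration.integral_sum) (rule int)
  also have "\<dots> = M (Suc m) + (\<Sum>b\<in>B - {e}. \<integral>s. cmod (ip s e) ^ (2 * m) * (cmod (ip s b))\<^sup>2 \<partial>\<mu>)"
    using e fin by (simp add: sum.remove[of B e] M_def power2_eq_square mult_ac)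
  finally have sum: "M m = \<dots>" .
  have "real (card B - 1) * M (Suc m) = (\<Sum>b\<in>B - {e}. M (Suc m))"
    using e fin by simp
  also have "\<dots> \<le> (\<Sum>b\<in>B - {e}. (2 * real m + 1) * (\<integral>s. cmod (ip s e) ^ (2 * m) * (cmod (ip s b))\<^sup>2 \<partial>\<mu>))"
    unfolding M_def using e on BW by (intro sum_mono mixed_moment) (auto simp: subset_iff)
  also have "\<dots> = (2 * real m + 1) * (M m - M (Suc m))"
    using sum by (simp add: sum_distrib_left)
  finally have "real (card B - 1) * M (Suc m) \<le> (2 * real m + 1) * (M m - M (Suc m))" .
  moreover have "real (card B - 1) = real (card B) - 1"
  proof -
    have "card B \<noteq> 0" using e fin by auto
    then show ?thesis by (simp add: of_nat_diff)
  qed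
  ultimately have "real (card B) * M (Suc m) + 2 * real m * M (Suc m) \<le> (2 * real m + 1) * M m"
    by (simp add: algebra_simps)
  moreover have "0 \<le> 2 * real m * M (Suc m)" using M0 by simp
  ultimately have "real (card B) * M (Suc m) \<le> 2 * real (Suc m) * M m"
    using M0[of m] by (simp add: algebra_simps)
  then show ?thesis by (simp add: M_def)
qed

lemma moment_bound:
  assumes B: "orthonormal_set B" "W \<subseteq> sec.span B" "B \<noteq> {}" and v: "v \<in> W"
  shows "(\<integral>s. cmod (ip s v) ^ (2 * n) \<partial>\<mu>) \<le> (2 * real n * Re (ip v v) / real (card B)) ^ n"
proof -
  obtain e where e: "e \<in> B" using B by auto
  have eW: "e \<in> W" "ip e e = 1" using B e by (auto simp: orthonormal_set_def)
  define k where "k = real (card B)"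
  have k: "k > 0" using B e by (auto simp: k_def orthonormal_set_def card_gt_0_iff)
  define M where "M n = (\<integral>s. cmod (ip s e) ^ (2 * n) \<partial>\<mu>)" for n
  have "M m \<le> (2 * real n / k) ^ m" if "m \<le> n" for m
    using that
  proof (induction m)
    case 0
    show ?case by (simp add: M_def measure_sphere)
  next
    case (Suc m)
    have "k * M (Suc m) \<le> 2 * real (Suc m) * M m"
      using moment_recursion[OF B(1,2) e, of m] by (simp add: k_def M_def)
    also have "\<dots> \<le> 2 * real n * M m"
      using Suc.prems by (intro mult_right_mono) (auto simp: M_def)
    also have "\<dots> \<le> 2 * real n * (2 * real n / k) ^ m"
      using Suc by (intro mult_left_mono) auto
    finally show ?case using k by (simp add: field_simps)
  qed
  then have "M n \<le> (2 * real n / k) ^ n" by simp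
  then have "Re (ip v v) ^ n * M n \<le> Re (ip v v) ^ n * (2 * real n / k) ^ n"
    using ip_nonneg[OF v] by (intro mult_left_mono) auto
  then show ?thesis
    using moment_scale[OF v eW, of n] by (simp add: M_def k_def power_mult_distrib power_divide mult_ac)
qed

lemma eval_expand:
  assumes B: "orthonormal_set B" "W \<subseteq> sec.span B" and s: "s \<in> W"
  shows "s i p = (\<Sum>b\<in>B. ip s b * b i p)"
proof -
  have "s i p = (\<Sum>b\<in>B. sscale (ip s b) b) i p" using onb_expand[OF B s] by metis
  then show ?thesis by (simp add: sum_section_apply sscale_apply)
qed

text \<open>
  Evaluation of one coefficient at a point is the product with the coherent state
  \<open>v = \<Sum> cnj (b(p)) b\<close>, whose squared norm is the sum on the right.
\<close>

lemma eval_moment: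
  assumes B: "orthonormal_set B" "W \<subseteq> sec.span B" "B \<noteq> {}"
  shows "(\<integral>s. cmod (s i p) ^ (2 * n) \<partial>\<mu>)
     \<le> (2 * real n * (\<Sum>b\<in>B. (cmod (b i p))\<^sup>2) / real (card B)) ^ n"
proof -
  have BW: "b \<in> W" if "b \<in> B" for b using B that by (auto simp: orthonormal_set_def)
  define v where "v = (\<Sum>b\<in>B. sscale (cnj (b i p)) b)"
  have v: "v \<in> W" unfolding v_def by (intro W_sum W_scale BW)
  have repr: "ip s v = s i p" if s: "s \<in> W" for s
  proof -
    have "ip s v = (\<Sum>b\<in>B. ip s (sscale (cnj (b i p)) b))"
      unfolding v_def by (intro ip_sum_right W_scale BW s)
    also have "\<dots> = (\<Sum>b\<in>B. ip s b * b i p)"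
      by (intro sum.cong) (simp_all add: ip_scale_right BW s mult.commute)
    finally show ?thesis using eval_expand[OF B(1,2) s] by simp
  qed
  have "ip v v = v i p" by (rule repr[OF v])
  also have "\<dots> = (\<Sum>b\<in>B. complex_of_real ((cmod (b i p))\<^sup>2))"
    unfolding v_def by (simp add: sum_section_apply sscale_apply complex_norm_square mult.commute del: of_real_power)
  finally have "Re (ip v v) = (\<Sum>b\<in>B. (cmod (b i p))\<^sup>2)" by simp
  moreover have "(\<integral>s. cmod (s i p) ^ (2 * n) \<partial>\<mu>) = (\<integral>s. cmod (ip s v) ^ (2 * n) \<partial>\<mu>)"
    by (rule Bochner_Integration.integral_cong) (simp_all add: space_\<mu> usphere_def repr)
  ultimately show ?thesis using moment_bound[OF B v, of n] by simp
qed

lemma eval_tail: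
  assumes B: "orthonormal_set B" "W \<subseteq> sec.span B" "B \<noteq> {}"
    and a: "(\<Sum>b\<in>B. (cmod (b i p))\<^sup>2) \<le> a" and t: "0 < t"
  shows "measure \<mu> {s \<in> usphere. sqrt (a * t) < cmod (s i p)} \<le> (2 * real n / (real (card B) * t)) ^ n"
proof -
  have fin: "finite B" using B by (simp add: orthonormal_set_def)
  define \<sigma> where "\<sigma> = (\<Sum>b\<in>B. (cmod (b i p))\<^sup>2)"
  have \<sigma>: "0 \<le> \<sigma>" "\<sigma> \<le> a" using a by (simp_all add: \<sigma>_def sum_nonneg)
  show ?thesis
  \<comment> \<open>If the kernel vanishes at p, then so does every section, and the strict inequality never holds.\<close>
  proof (cases "a = 0")
    case True
    then have "\<sigma> = 0" using \<sigma> by simp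
    then have zero: "b i p = 0" if "b \<in> B" for b
      using that fin by (simp add: \<sigma>_def sum_nonneg_eq_0_iff)
    have "s i p = 0" if "s \<in> usphere" for s
    proof -
      have "s i p = (\<Sum>b\<in>B. ip s b * b i p)"
        using that by (intro eval_expand[OF B(1,2)]) (simp add: usphere_def)
      also have "\<dots> = 0" by (intro sum.neutral) (simp add: zero)
      finally show ?thesis .
    qed
    then have empty: "{s \<in> usphere. sqrt (a * t) < cmod (s i p)} = {}" using True by auto
    show ?thesis unfolding empty using t by simp
  next
    case False
    then have a0: "a > 0" using \<sigma> by simp
    have [measurable]: "(\<lambda>s. cmod (s i p)) \<in> borel_measurable \<mu>"
      using measurable_eval by measurable
    have "\<bar>cmod (s i p) ^ (2 * n)\<bar> \<le> (\<Sum>b\<in>B. cmod (b i p)) ^ (2 * n)" if "s \<in> usphere" for s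
    proof -
      have "s \<in> W" using that by (simp add: usphere_def)
      have "cmod (s i p) \<le> (\<Sum>b\<in>B. cmod (ip s b * b i p))"
        by (subst eval_expand[OF B(1,2) \<open>s \<in> W\<close>]) (rule norm_sum)
      also have "\<dots> \<le> (\<Sum>b\<in>B. 1 * cmod (b i p))"
        unfolding norm_mult
      proof (intro sum_mono mult_right_mono)
        fix b assume "b \<in> B"
        then have "b \<in> W" "ip b b = 1" using B(1) by (auto simp: orthonormal_set_def)
        then show "cmod (ip s b) \<le> 1" by (rule bessel[OF _ _ that])
      qed simp
      finally show ?thesis by (simp add: power_mono)
    qed
    then have int: "integrable \<mu> (\<lambda>s. cmod (s i p) ^ (2 * n))"
      by (intro integrable_bounded) auto
    have "measure \<mu> {s \<in> usphere. sqrt (a * t) < cmod (s i p)}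
        \<le> measure \<mu> {s \<in> space \<mu>. (a * t) ^ n \<le> cmod (s i p) ^ (2 * n)}"
    proof (rule finite_measure_mono)
      show "{s \<in> usphere. sqrt (a * t) < cmod (s i p)} \<subseteq> {s \<in> space \<mu>. (a * t) ^ n \<le> cmod (s i p) ^ (2 * n)}"
      proof
        fix s assume s: "s \<in> {s \<in> usphere. sqrt (a * t) < cmod (s i p)}"
        then have "(sqrt (a * t))\<^sup>2 \<le> (cmod (s i p))\<^sup>2"
          using a0 t by (intro power_mono) auto
        then have "a * t \<le> (cmod (s i p))\<^sup>2" using a0 t by simp
        then have "(a * t) ^ n \<le> ((cmod (s i p))\<^sup>2) ^ n" using a0 t by (intro power_mono) auto
        then show "s \<in> {s \<in> space \<mu>. (a * t) ^ n \<le> cmod (s i p) ^ (2 * n)}"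
          using s by (simp add: space_\<mu> power_mult)
      qed
    qed measurable
    also have "\<dots> \<le> (\<integral>s. cmod (s i p) ^ (2 * n) \<partial>\<mu>) / (a * t) ^ n"
      by (rule integral_Markov_inequality_measure[OF int sets.empty_sets]) (use a0 t in auto)
    also have "\<dots> \<le> (2 * real n * \<sigma> / real (card B)) ^ n / (a * t) ^ n"
      using eval_moment[OF B] a0 t unfolding \<sigma>_def by (intro divide_right_mono) auto
    also have "\<dots> = (2 * real n * \<sigma> / real (card B) / (a * t)) ^ n"
      by (rule power_divide[symmetric])
    also have "\<dots> \<le> (2 * real n / (real (card B) * t)) ^ n"
    proof (rule power_mono)
      have "2 * real n * \<sigma> / real (card B) / (a * t) \<le> 2 * real n * a / real (card B) / (a * t)"
        using \<sigma> a0 t by (intro divide_right_mono mult_left_mono) auto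
      also have "\<dots> = 2 * real n / (real (card B) * t)" using a0 by simp
      finally show "2 * real n * \<sigma> / real (card B) / (a * t) \<le> 2 * real n / (real (card B) * t)" .
    qed (use \<sigma> a0 t in auto)
    finally show ?thesis .
  qed
qed

end

section \<open>Nets of polynomial size\<close>

lemma cball_doubling:
  "\<exists>N. \<forall>(x::'a::euclidean_space) r. r > 0 \<longrightarrow>
     (\<exists>F. finite F \<and> card F \<le> N \<and> cball x r \<subseteq> (\<Union>y\<in>F. cball y (r / 2)))"
proof -
  have "compact (cball (0::'a) 1)" by simp
  then obtain F where F: "finite F" "cball (0::'a) 1 \<subseteq> (\<Union>y\<in>F. ball y (1 / 2))"
    unfolding compact_eq_totally_bounded by (metis half_gt_zero_iff zero_less_one)
  show ?thesis
  proof (intro exI[of _ "card F"] allI impI)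
    fix x :: 'a and r :: real assume r: "r > 0"
    have "cball x r \<subseteq> (\<Union>y\<in>(\<lambda>y. x + r *\<^sub>R y) ` F. cball y (r / 2))"
    proof
      fix z assume "z \<in> cball x r"
      define w where "w = (1 / r) *\<^sub>R (z - x)"
      have zw: "z = x + r *\<^sub>R w" using r by (simp add: w_def)
      have "w \<in> cball 0 1" using \<open>z \<in> cball x r\<close> r by (simp add: w_def dist_norm norm_minus_commute)
      then obtain y where y: "y \<in> F" "dist y w < 1 / 2" using F(2) by auto
      have "dist (x + r *\<^sub>R y) z = r * dist y w"
        using r by (simp add: zw dist_norm flip: scaleR_diff_right)
      also have "\<dots> \<le> r / 2" using y(2) r by simp
      finally show "z \<in> (\<Union>y\<in>(\<lambda>y. x + r *\<^sub>R y) ` F. cball y (r / 2))" using y(1) by auto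
    qed
    then show "\<exists>F'. finite F' \<and> card F' \<le> card F \<and> cball x r \<subseteq> (\<Union>y\<in>F'. cball y (r / 2))"
      using F(1) by (intro exI[of _ "(\<lambda>y. x + r *\<^sub>R y) ` F"]) (auto simp: card_image_le)
  qed
qed

text \<open>
  Iterating the doubling property counts the balls needed at scale \<open>2\<^sup>-\<^sup>j\<close> by \<open>N\<^sup>j\<close>, which is a power of
  the inverse scale.
\<close>

lemma cball_dyadic_cover:
  "\<exists>N. \<forall>j (x::'a::euclidean_space) r. r > 0 \<longrightarrow>
     (\<exists>F. finite F \<and> card F \<le> N ^ j \<and> cball x r \<subseteq> (\<Union>y\<in>F. cball y (r / 2 ^ j)))"
proof -
  obtain N where N: "\<And>(x::'a) r. r > 0 \<Longrightarrow>
      \<exists>F. finite F \<and> card F \<le> N \<and> cball x r \<subseteq> (\<Union>y\<in>F. cball y (r / 2))"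
    using cball_doubling by blast
  have "\<exists>F. finite F \<and> card F \<le> N ^ j \<and> cball x r \<subseteq> (\<Union>y\<in>F. cball y (r / 2 ^ j))"
    if r: "r > 0" for j and x :: 'a and r
  proof (induction j)
    case 0
    show ?case by (rule exI[of _ "{x}"]) simp
  next
    case (Suc j)
    then obtain F where F: "finite F" "card F \<le> N ^ j" "cball x r \<subseteq> (\<Union>y\<in>F. cball y (r / 2 ^ j))"
      by blast
    have "\<forall>y::'a. \<exists>G. finite G \<and> card G \<le> N \<and> cball y (r / 2 ^ j) \<subseteq> (\<Union>z\<in>G. cball z (r / 2 ^ j / 2))"
      by (rule allI, rule N) (use r in simp)
    then obtain G :: "'a \<Rightarrow> 'a set" where G: "\<And>y. finite (G y)" "\<And>y. card (G y) \<le> N"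
        "\<And>y. cball y (r / 2 ^ j) \<subseteq> (\<Union>z\<in>G y. cball z (r / 2 ^ j / 2))"
      by metis
    have "card (\<Union>y\<in>F. G y) \<le> (\<Sum>y\<in>F. card (G y))" by (rule card_UN_le) (rule F)
    also have "\<dots> \<le> card F * N" using sum_bounded_above[of F "\<lambda>y. card (G y)" N] G by simp
    also have "\<dots> \<le> N ^ Suc j" using F(2) by (simp add: mult.commute)
    finally have "card (\<Union>y\<in>F. G y) \<le> N ^ Suc j" .
    moreover have "cball x r \<subseteq> (\<Union>z\<in>(\<Union>y\<in>F. G y). cball z (r / 2 ^ Suc j))"
      using F(3) G(3) by (simp add: field_simps) blast
    moreover have "finite (\<Union>y\<in>F. G y)" using F G by auto
    ultimately show ?case by blast
  qed
  then show ?thesis by blast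
qed

lemma polynomial_net:
  fixes S :: "'a::euclidean_space set"
  assumes "bounded S" and \<delta>: "\<delta> > 0"
  shows "\<exists>K a. \<forall>d\<ge>1. \<exists>F\<subseteq>S. finite F \<and> card F \<le> K * d ^ a \<and> (\<forall>z\<in>S. \<exists>y\<in>F. dist z y \<le> \<delta> / real d)"
proof -
  obtain N where N: "\<And>j (x::'a) r. r > 0 \<Longrightarrow>
     \<exists>F. finite F \<and> card F \<le> N ^ j \<and> cball x r \<subseteq> (\<Union>y\<in>F. cball y (r / 2 ^ j))"
    using cball_dyadic_cover by blast
  obtain x r where "S \<subseteq> cball x r" using \<open>bounded S\<close> bounded_subset_cball by blast
  then have S: "S \<subseteq> cball x (max r 1)" by auto
  define R where "R = max r 1"
  have R: "R > 0" by (simp add: R_def)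
  obtain c where c: "2 * R / \<delta> < 2 ^ c" using real_arch_pow[of 2] by auto
  show ?thesis
  proof (rule exI[of _ "N ^ Suc c"], rule exI[of _ N], intro allI impI)
    fix d :: nat assume d: "d \<ge> 1"
    obtain l where l: "2 ^ l \<le> d" "d < 2 ^ (l + 1)"
      using ex_power_ivl1[of 2 d] d by auto
    define j where "j = c + (l + 1)"
    obtain F where F: "finite F" "card F \<le> N ^ j" "cball x R \<subseteq> (\<Union>y\<in>F. cball y (R / 2 ^ j))"
      using N[OF R] by blast
    \<comment> \<open>The centres need not lie in the set: each one whose ball meets the set is replaced by a
        point of the set in that ball, which costs a factor 2 in the mesh.\<close>
    define F' where "F' = {y \<in> F. cball y (R / 2 ^ j) \<inter> S \<noteq> {}}"
    define g where "g y = (SOME z. z \<in> cball y (R / 2 ^ j) \<inter> S)" for y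
    have g: "g y \<in> cball y (R / 2 ^ j) \<inter> S" if "y \<in> F'" for y
      unfolding g_def using that by (intro someI_ex[of "\<lambda>z. z \<in> cball y (R / 2 ^ j) \<inter> S"]) (auto simp: F'_def)
    have mesh: "2 * (R / 2 ^ j) \<le> \<delta> / real d"
    proof -
      have "real d \<le> real (2 ^ (l + 1))" using l(2) by (intro of_nat_mono) simp
      then have 1: "real d \<le> 2 ^ (l + 1)" by simp
      have 2: "2 * R \<le> 2 ^ c * \<delta>" using c \<delta> by (simp add: field_simps)
      have "2 * R * real d \<le> (2 ^ c * \<delta>) * 2 ^ (l + 1)"
        by (rule mult_mono[OF 2 1]) (use \<delta> in auto)
      also have "\<dots> = \<delta> * 2 ^ j" by (simp add: j_def power_add)
      finally show ?thesis using d by (simp add: field_simps)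
    qed
    have "N ^ j = N ^ Suc c * N ^ l" by (simp add: j_def power_add)
    also have "N ^ l \<le> (2 ^ N) ^ l" using less_exp[of N] by (intro power_mono) auto
    also have "(2 ^ N) ^ l = ((2::nat) ^ l) ^ N" by (simp add: power_mult[symmetric] mult.commute)
    also have "\<dots> \<le> d ^ N" using l(1) by (intro power_mono) auto
    finally have "N ^ j \<le> N ^ Suc c * d ^ N" by simp
    moreover have "card (g ` F') \<le> card F"
      using F(1) card_image_le[of F' g] card_mono[of F F'] by (auto simp: F'_def intro: le_trans)
    ultimately have "card (g ` F') \<le> N ^ Suc c * d ^ N" using F(2) by linarith
    moreover have "\<exists>y\<in>g ` F'. dist z y \<le> \<delta> / real d" if z: "z \<in> S" for z
    proof -
      have "z \<in> cball x R" using z S unfolding R_def by blast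
      then obtain y where y: "y \<in> F" "z \<in> cball y (R / 2 ^ j)" using F(3) by blast
      then have "y \<in> F'" using z by (auto simp: F'_def)
      have "dist z (g y) \<le> dist z y + dist y (g y)" by (rule dist_triangle)
      also have "\<dots> \<le> 2 * (R / 2 ^ j)" using y(2) g[OF \<open>y \<in> F'\<close>] by (simp add: dist_commute)
      also note mesh
      finally show ?thesis using \<open>y \<in> F'\<close> by blast
    qed
    ultimately show "\<exists>F\<subseteq>S. finite F \<and> card F \<le> N ^ Suc c * d ^ N \<and> (\<forall>z\<in>S. \<exists>y\<in>F. dist z y \<le> \<delta> / real d)"
      using g F(1) by (intro exI[of _ "g ` F'"]) (auto simp: F'_def)
  qed
qed

section \<open>Oscillation of weighted holomorphic functions\<close>

lemma holomorphic_oscillation: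
  assumes hol: "g holomorphic_on ball 0 1" and bd: "\<And>t. t \<in> ball 0 1 \<Longrightarrow> cmod (g t) \<le> B"
  shows "cmod (g (1 / 16) - g 0) \<le> B / 4"
proof -
  have der: "(g has_field_derivative deriv g t) (at t)" if "t \<in> ball 0 1" for t
    using holomorphic_derivI[OF hol open_ball that] .
  have "cmod (deriv g t) \<le> 4 * B" if t: "t \<in> cball 0 (1 / 2)" for t
  proof -
    have sub: "cball t (1 / 4) \<subseteq> ball 0 1"
    proof
      fix w assume "w \<in> cball t (1 / 4)"
      then show "w \<in> ball 0 1" using t dist_triangle[of 0 w t] by (simp add: dist_commute)
    qed
    have "cmod ((deriv ^^ 1) g t) \<le> fact 1 * B / (1 / 4) ^ 1"
    proof (rule Cauchy_inequality)
      show "g holomorphic_on ball t (1 / 4)"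
        using hol sub ball_subset_cball by (blast intro: holomorphic_on_subset)
      show "continuous_on (cball t (1 / 4)) g"
        using holomorphic_on_imp_continuous_on[OF hol] sub by (rule continuous_on_subset)
      fix x assume "cmod (t - x) = 1 / 4"
      then have "x \<in> cball t (1 / 4)" by (simp add: dist_norm)
      then show "cmod (g x) \<le> B" using sub by (intro bd) blast
    qed auto
    then show ?thesis by simp
  qed
  moreover have "cball 0 (1 / 2) \<subseteq> ball (0::complex) 1" by auto
  ultimately have "cmod (g (1 / 16) - g 0) \<le> 4 * B * cmod (1 / 16 - 0)"
    by (intro field_differentiable_bound[where S = "cball 0 (1 / 2)" and f' = "deriv g"])
      (auto intro: DERIV_subset[OF der])
  then show ?thesis by (simp add: norm_divide)
qed

lemma norm_vector_scalar_mult: "norm (c *s v) = cmod c * norm v" for v :: "complex^'m"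
  by (simp add: norm_vec_def L2_set_def norm_mult power_mult_distrib real_sqrt_mult flip: sum_distrib_left)

lemma bounded_linear_vector_scalar_mult: "bounded_linear (\<lambda>t. t *s v)" for v :: "complex^'m"
proof (rule bounded_linear_intro[where K = "norm v"])
  show "norm (t *s v) \<le> norm t * norm v" for t by (simp add: norm_vector_scalar_mult)
qed (auto simp: vec_eq_iff algebra_simps)

lemma hol_fun_on_line:
  assumes hol: "hol_fun_on f S" and S: "\<And>t. t \<in> T \<Longrightarrow> z + t *s v \<in> S" and T: "open T"
  shows "(\<lambda>t. f (z + t *s v)) holomorphic_on T"
  unfolding holomorphic_on_open[OF T]
proof
  fix t assume "t \<in> T"
  then obtain f' where f': "(f has_derivative f') (at (z + t *s v))" "\<And>c w. f' (c *s w) = c * f' w"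
    using hol S unfolding hol_fun_on_def by blast
  have "((\<lambda>t. z + t *s v) has_derivative (\<lambda>h. h *s v)) (at t)"
    using bounded_linear.has_derivative[OF bounded_linear_vector_scalar_mult has_derivative_ident]
    by (auto intro!: derivative_eq_intros)
  from has_derivative_compose[OF this f'(1)]
  have "((\<lambda>t. f (z + t *s v)) has_derivative (\<lambda>h. f' v * h)) (at t)"
    by (simp add: f'(2) mult.commute)
  then show "\<exists>D. ((\<lambda>t. f (z + t *s v)) has_field_derivative D) (at t)"
    unfolding has_field_derivative_def by blast
qed

text \<open>
  On the ball of radius \<open>\<rho>/d\<close> around \<open>z\<close> the weight \<open>u\<^sup>d\<close> changes by at most a factor \<open>(1 + 1/d)\<^sup>d \<le> 4\<close>, so that
  \<open>|f|\<close> is bounded there by \<open>2M\<close> in the units given by the weight at \<open>z\<close>. Cauchy's inequality on the complex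
  line through \<open>z\<close> and \<open>y\<close> then bounds \<open>|f(z) - f(y)|\<close> by \<open>M/2\<close> in these units, because
  \<open>y\<close> is sixteen times closer to \<open>z\<close> than the radius.
\<close>

lemma weighted_oscillation:
  fixes f :: "complex^'m \<Rightarrow> complex" and u :: "complex^'m \<Rightarrow> real"
  assumes hol: "hol_fun_on f (ball c (2 * r))"
    and u_pos: "\<And>w. w \<in> ball c (2 * r) \<Longrightarrow> 0 < u w"
    and u_lip: "\<And>z w. \<lbrakk>z \<in> ball c (2 * r); w \<in> ball c (2 * r)\<rbrakk> \<Longrightarrow> u z \<le> u w * (1 + \<Lambda> * dist z w)"
    and \<rho>: "0 < \<rho>" "\<rho> \<le> r" "\<Lambda> * \<rho> \<le> 1" "0 \<le> \<Lambda>" and d: "1 \<le> (d::nat)"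
    and M: "\<And>w. w \<in> ball c (2 * r) \<Longrightarrow> cmod (f w) * sqrt (u w ^ d) \<le> M"
    and z: "z \<in> ball c r" and zy: "dist z y \<le> \<rho> / 16 / real d"
  shows "cmod (f z) * sqrt (u z ^ d) \<le> 2 * (cmod (f y) * sqrt (u y ^ d)) + M / 2"
proof -
  define v where "v = (16::complex) *s (y - z)"
  have nv: "norm v \<le> \<rho> / real d"
    unfolding v_def norm_vector_scalar_mult
    using zy by (simp add: dist_norm norm_minus_commute field_simps)
  have \<rho>d: "\<rho> / real d \<le> \<rho>" using d \<rho>(1) by (simp add: field_simps)
  have z2: "z \<in> ball c (2 * r)" using z \<rho> by auto
  have near: "w \<in> ball c (2 * r) \<and> sqrt (u z ^ d) \<le> 2 * sqrt (u w ^ d)" if w: "dist z w \<le> \<rho> / real d" for w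
  proof
    have "dist c w \<le> dist c z + dist z w" by (rule dist_triangle)
    also have "\<dots> < r + r" using z w \<rho>d \<rho>(2) by simp
    finally show wb: "w \<in> ball c (2 * r)" by simp
    have "\<Lambda> * dist z w \<le> \<Lambda> * (\<rho> / real d)" using w \<rho> by (intro mult_left_mono) auto
    also have "\<dots> \<le> 1 / real d" using \<rho>(3) d by (simp add: field_simps)
    finally have "u z \<le> u w * (1 + 1 / real d)"
      using u_lip[OF z2 wb] u_pos[OF wb] by (smt (verit) mult_left_mono)
    also have "\<dots> \<le> u w * exp (1 / real d)"
      using u_pos[OF wb] by (intro mult_left_mono exp_ge_add_one_self) auto
    finally have "u z ^ d \<le> (u w * exp (1 / real d)) ^ d"
      using u_pos[OF z2] by (intro power_mono) auto
    also have "\<dots> = u w ^ d * exp 1"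
      using d by (simp add: power_mult_distrib flip: exp_of_nat_mult)
    also have "\<dots> \<le> u w ^ d * 2\<^sup>2"
      using u_pos[OF wb] exp_le by (intro mult_left_mono) auto
    finally have "sqrt (u z ^ d) \<le> sqrt (u w ^ d * 2\<^sup>2)" by (rule real_sqrt_le_mono)
    then show "sqrt (u z ^ d) \<le> 2 * sqrt (u w ^ d)" by (simp add: real_sqrt_mult)
  qed
  define A where "A = sqrt (u z ^ d)"
  have A: "A > 0" using u_pos[OF z2] by (simp add: A_def)
  have close: "dist z (z + t *s v) \<le> \<rho> / real d" if "cmod t \<le> 1" for t
  proof -
    have "dist z (z + t *s v) = cmod t * norm v" by (simp add: dist_norm norm_vector_scalar_mult)
    also have "\<dots> \<le> 1 * norm v" using that by (intro mult_right_mono) auto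
    finally show ?thesis using nv by simp
  qed
  have "cmod (f (z + (1 / 16) *s v) - f (z + 0 *s v)) \<le> (2 * M / A) / 4"
  proof (rule holomorphic_oscillation[where g = "\<lambda>t. f (z + t *s v)"])
    show "(\<lambda>t. f (z + t *s v)) holomorphic_on ball 0 1"
      using near[OF close] by (intro hol_fun_on_line[OF hol]) auto
    fix t :: complex assume "t \<in> ball 0 1"
    then have t: "dist z (z + t *s v) \<le> \<rho> / real d" by (intro close) simp
    have "cmod (f (z + t *s v)) * A \<le> cmod (f (z + t *s v)) * (2 * sqrt (u (z + t *s v) ^ d))"
      unfolding A_def using near[OF t] by (intro mult_left_mono) auto
    also have "\<dots> \<le> 2 * M" using M[of "z + t *s v"] near[OF t] by simp
    finally show "cmod (f (z + t *s v)) \<le> 2 * M / A" using A by (simp add: field_simps)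
  qed
  moreover have "z + (1 / 16) *s v = y" by (simp add: v_def vec_eq_iff)
  ultimately have "cmod (f y - f z) \<le> M / (2 * A)" by simp
  then have "cmod (f z) \<le> cmod (f y) + M / (2 * A)"
    using norm_triangle_ineq2[of "f z" "f y"] by (simp add: norm_minus_commute)
  then have "cmod (f z) * A \<le> (cmod (f y) + M / (2 * A)) * A" using A by (intro mult_right_mono) auto
  also have "\<dots> = cmod (f y) * A + M / 2" using A by (simp add: field_simps)
  also have "cmod (f y) * A \<le> cmod (f y) * (2 * sqrt (u y ^ d))"
  proof -
    have "\<rho> / 16 / real d \<le> \<rho> / real d" using \<rho>(1) d by (simp add: field_simps)
    then show ?thesis unfolding A_def using near[of y] zy by (intro mult_left_mono) auto
  qed
  finally show ?thesis by (simp add: A_def)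
qed

text \<open>
  A multiplicative Lipschitz bound: in contrast to the additive one, it survives raising to the
  \<open>d\<close>-th power at distance \<open>1/d\<close>.
\<close>

lemma C1_positive_ratio_bound:
  fixes u :: "'a::euclidean_space \<Rightarrow> real"
  assumes u: "Ck_on 1 u D" and cb: "cball c R \<subseteq> D" and pos: "\<And>w. w \<in> D \<Longrightarrow> 0 < u w"
  shows "\<exists>\<Lambda>\<ge>0. \<forall>z\<in>cball c R. \<forall>w\<in>cball c R. u z \<le> u w * (1 + \<Lambda> * dist z w)"
proof (cases "cball c R = {}")
  case True
  then show ?thesis by auto
next
  case False
  have der: "(u has_derivative frechet_derivative u (at x)) (at x)" if "x \<in> D" for x
    using u that by (simp add: frechet_derivative_works[symmetric])
  have derW: "(u has_derivative frechet_derivative u (at x)) (at x within cball c R)"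
    if "x \<in> cball c R" for x
    using der[of x] cb that has_derivative_at_withinI by blast
  have cont: "continuous_on D (\<lambda>x. frechet_derivative u (at x) v)" for v
    using u by simp
  have "\<exists>C. \<forall>x\<in>cball c R. norm (frechet_derivative u (at x) b) \<le> C" for b
  proof -
    have "compact ((\<lambda>x. frechet_derivative u (at x) b) ` cball c R)"
      by (intro compact_continuous_image continuous_on_subset[OF cont cb] compact_cball)
    then have "bounded ((\<lambda>x. frechet_derivative u (at x) b) ` cball c R)"
      by (rule compact_imp_bounded)
    then show ?thesis by (auto simp: bounded_iff)
  qed
  then obtain C where C: "\<And>x b. x \<in> cball c R \<Longrightarrow> norm (frechet_derivative u (at x) b) \<le> C b" by metis
  define L where "L = (\<Sum>b\<in>Basis. C b)"
  have on: "onorm (frechet_derivative u (at x)) \<le> L" if x: "x \<in> cball c R" for x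
  proof (rule onorm_le)
    have lin: "linear (frechet_derivative u (at x))"
      using der[of x] x cb by (blast intro: has_derivative_linear)
    fix v
    have "frechet_derivative u (at x) v = (\<Sum>b\<in>Basis. (v \<bullet> b) *\<^sub>R frechet_derivative u (at x) b)"
      by (subst euclidean_representation[of v, symmetric]) (simp only: linear_sum[OF lin] linear_scale[OF lin])
    then have "norm (frechet_derivative u (at x) v) \<le> (\<Sum>b\<in>Basis. norm ((v \<bullet> b) *\<^sub>R frechet_derivative u (at x) b))"
      by (simp only: norm_sum)
    also have "\<dots> \<le> (\<Sum>b\<in>Basis. norm v * C b)"
      using C[OF x] by (intro sum_mono) (auto simp: abs_mult Basis_le_norm intro!: mult_mono)
    finally show "norm (frechet_derivative u (at x) v) \<le> L * norm v"
      by (simp add: L_def sum_distrib_left mult.commute)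
  qed
  have contu: "continuous_on (cball c R) u"
    using der cb has_derivative_continuous by (intro continuous_at_imp_continuous_on) blast
  obtain x0 where x0: "x0 \<in> cball c R" "\<And>x. x \<in> cball c R \<Longrightarrow> u x0 \<le> u x"
    using continuous_attains_inf[OF compact_cball False contu] by blast
  have m: "u x0 > 0" using x0 cb pos by blast
  have L0: "0 \<le> L" using onorm_pos_le[OF has_derivative_bounded_linear[OF der]] on x0(1) cb by fastforce
  show ?thesis
  proof (intro exI[of _ "L / u x0"] conjI ballI)
    show "0 \<le> L / u x0" using L0 m by simp
    fix z w assume zw: "z \<in> cball c R" "w \<in> cball c R"
    have "norm (u z - u w) \<le> L * norm (z - w)"
      by (rule differentiable_bound[OF convex_cball derW on zw])
    then have "u z \<le> u w + L * dist z w" by (simp add: dist_norm)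
    also have "L * dist z w = L / u x0 * dist z w * u x0" using m by simp
    also have "\<dots> \<le> L / u x0 * dist z w * u w"
      using x0(2)[OF zw(2)] L0 m by (intro mult_left_mono) auto
    finally show "u z \<le> u w * (1 + L / u x0 * dist z w)" by (simp add: algebra_simps)
  qed
qed

section \<open>Continuity of the curvature\<close>

text \<open>
  Writing the second derivatives of \<open>ln u\<close> through those of \<open>u\<close> shows that the entries of the
  curvature matrix are continuous.
\<close>

lemma wirtinger_bar_ln_derivative:
  fixes u :: "complex^'m::finite \<Rightarrow> real"
  assumes u: "Ck_on 2 u D" and D: "open D" and pos: "\<And>w. w \<in> D \<Longrightarrow> 0 < u w" and z: "z \<in> D"
  defines "q \<equiv> \<lambda>a x. frechet_derivative u (at x) a / u x"
    and "Q \<equiv> \<lambda>a e x. (frechet_derivative (\<lambda>x. frechet_derivative u (at x) a) (at x) e * u x -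
                frechet_derivative u (at x) a * frechet_derivative u (at x) e) / (u x * u x)"
  shows "frechet_derivative (wirtinger_bar k (\<lambda>w. complex_of_real (ln (u w)))) (at z) e =
           (complex_of_real (Q (axis k 1) e z) + \<i> * complex_of_real (Q (axis k \<i>) e z)) / 2"
proof -
  have C1: "u differentiable at x" "(\<lambda>x. frechet_derivative u (at x) a) differentiable at x" if "x \<in> D" for x a
    using u that by (auto simp: numeral_2_eq_2)
  have du: "(u has_derivative frechet_derivative u (at x)) (at x)" if "x \<in> D" for x
    using C1(1)[OF that] by (simp add: frechet_derivative_works)
  have ddu: "((\<lambda>x. frechet_derivative u (at x) a) has_derivative
      frechet_derivative (\<lambda>x. frechet_derivative u (at x) a) (at x)) (at x)" if "x \<in> D" for x a
    using C1(2)[OF that] by (simp add: frechet_derivative_works)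
  have dq: "(q a has_derivative (\<lambda>e. Q a e x)) (at x)" if "x \<in> D" for x a
  proof -
    have "(q a has_derivative (\<lambda>h. - frechet_derivative u (at x) a *
        (inverse (u x) * frechet_derivative u (at x) h * inverse (u x)) +
        frechet_derivative (\<lambda>x. frechet_derivative u (at x) a) (at x) h / u x)) (at x)"
      unfolding q_def using pos[OF that]
      by (intro has_derivative_divide[OF ddu[OF that] du[OF that]]) auto
    then show ?thesis
      by (rule has_derivative_eq_rhs) (use pos[OF that] in \<open>auto simp: Q_def fun_eq_iff field_simps\<close>)
  qed
  have wb: "wirtinger_bar k (\<lambda>w. complex_of_real (ln (u w))) x =
      (complex_of_real (q (axis k 1) x) + \<i> * complex_of_real (q (axis k \<i>) x)) / 2" if "x \<in> D" for x
  proof -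
    have "((\<lambda>w. complex_of_real (ln (u w))) has_derivative
        (\<lambda>h. complex_of_real (frechet_derivative u (at x) h / u x))) (at x)"
      by (intro has_derivative_of_real has_derivative_eq_rhs[OF has_derivative_ln[OF pos du]])
        (use that in \<open>auto simp: fun_eq_iff divide_inverse\<close>)
    then have "frechet_derivative (\<lambda>w. complex_of_real (ln (u w))) (at x) =
        (\<lambda>h. complex_of_real (frechet_derivative u (at x) h / u x))"
      by (rule frechet_derivative_at[symmetric])
    then show ?thesis by (simp add: wirtinger_bar_def q_def)
  qed
  have "((\<lambda>x. (complex_of_real (q (axis k 1) x) + \<i> * complex_of_real (q (axis k \<i>) x)) / 2) has_derivative
      (\<lambda>e. (complex_of_real (Q (axis k 1) e z) + \<i> * complex_of_real (Q (axis k \<i>) e z)) / 2)) (at z)"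
    by (rule has_derivative_eq_rhs, (rule derivative_intros has_derivative_of_real dq z)+)
      (auto simp: fun_eq_iff)
  then have "(wirtinger_bar k (\<lambda>w. complex_of_real (ln (u w))) has_derivative
      (\<lambda>e. (complex_of_real (Q (axis k 1) e z) + \<i> * complex_of_real (Q (axis k \<i>) e z)) / 2)) (at z)"
    by (rule has_derivative_transform_within_open[OF _ D z]) (simp add: wb)
  from fun_cong[OF frechet_derivative_at[OF this, symmetric], of e] show ?thesis .
qed

lemma curvature_entry_continuous:
  fixes u :: "complex^'m::finite \<Rightarrow> real"
  assumes u: "Ck_on 2 u D" and D: "open D" and pos: "\<And>w. w \<in> D \<Longrightarrow> 0 < u w"
  shows "continuous_on D (wirtinger j (wirtinger_bar k (\<lambda>w. complex_of_real (ln (u w)))))"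
proof -
  have u': "Ck_on (Suc (Suc 0)) u D" using u by (simp only: numeral_2_eq_2)
  have "u differentiable at x" if "x \<in> D" for x using u' that by simp
  then have c0: "continuous_on D u"
    by (intro continuous_at_imp_continuous_on ballI differentiable_imp_continuous_within)
  have "(\<lambda>x. frechet_derivative u (at x) a) differentiable at x" if "x \<in> D" for x a
    using u' that by simp
  then have c1: "continuous_on D (\<lambda>x. frechet_derivative u (at x) a)" for a
    by (intro continuous_at_imp_continuous_on ballI differentiable_imp_continuous_within)
  have c2: "continuous_on D (\<lambda>x. frechet_derivative (\<lambda>x. frechet_derivative u (at x) a) (at x) e)" for a e
    using u' by simp
  have nz: "u x \<noteq> 0" if "x \<in> D" for x using pos[OF that] by simp
  have der: "continuous_on D (\<lambda>z. frechet_derivative (wirtinger_bar k (\<lambda>w. complex_of_real (ln (u w)))) (at z) e)" for e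
    by (subst continuous_on_cong[OF refl wirtinger_bar_ln_derivative[OF u D pos]])
      (use nz in \<open>auto intro!: continuous_intros c0 c1 c2\<close>)
  have eq: "wirtinger j f = (\<lambda>z. (frechet_derivative f (at z) (axis j 1)
      - \<i> * frechet_derivative f (at z) (axis j \<i>)) / 2)" for f
    by (simp add: wirtinger_def fun_eq_iff)
  show ?thesis unfolding eq by (intro continuous_intros der) auto
qed

lemma det_continuous:
  fixes M :: "'a::topological_space \<Rightarrow> complex^'m::finite^'m"
  assumes "\<And>j k. continuous_on D (\<lambda>z. M z $ j $ k)"
  shows "continuous_on D (\<lambda>z. det (M z))"
  unfolding det_def by (intro continuous_intros assms)

section \<open>Hermitian line bundles on compact manifolds\<close>

locale hermitian_bundle =
  fixes \<A> :: "('p::t2_space, 'm::finite) chart set"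
    and L :: "('p, 'i) line_bundle" and h :: "'i \<Rightarrow> 'p \<Rightarrow> real"
  assumes manifold: "compact_complex_manifold \<A>"
    and hol_bundle: "hol_line_bundle \<A> L"
    and metric: "hermitian_metric \<A> L h"
begin

lemma chart:
  assumes "(U, \<phi>) \<in> \<A>" "i \<in> bidx L"
  shows chart_open: "open U" and chart_continuous: "continuous_on U \<phi>"
    and chart_inv: "\<And>q. q \<in> U \<Longrightarrow> inv_into U \<phi> (\<phi> q) = q"
    and chart_image_open: "open (\<phi> ` (U \<inter> bdom L i))"
    and bdom_open: "open (bdom L i)"
proof -
  have "\<forall>(U, \<phi>)\<in>\<A>. open U \<and> open (\<phi> ` U) \<and> homeomorphism U (\<phi> ` U) \<phi> (inv_into U \<phi>)"
    using manifold by (simp add: compact_complex_manifold_def hol_atlas_def)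
  then have c: "open U" "open (\<phi> ` U)" "homeomorphism U (\<phi> ` U) \<phi> (inv_into U \<phi>)"
    using assms(1) by auto
  show "open U" by (rule c)
  show "continuous_on U \<phi>" using c(3) by (simp add: homeomorphism_def)
  show "inv_into U \<phi> (\<phi> q) = q" if "q \<in> U" for q by (rule homeomorphism_apply1[OF c(3) that])
  show "open (bdom L i)" using hol_bundle assms(2) by (simp add: hol_line_bundle_def)
  then have "openin (top_of_set U) (U \<inter> bdom L i)" by auto
  then have "openin (top_of_set (\<phi> ` U)) (\<phi> ` (U \<inter> bdom L i))"
    by (rule homeomorphism_imp_open_map[OF c(3)])
  then show "open (\<phi> ` (U \<inter> bdom L i))" using c(2) by (simp add: openin_open_eq)
qed

lemma chart_neighbourhood:
  obtains U \<phi> i r where "(U, \<phi>) \<in> \<A>" "i \<in> bidx L" "0 < r"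
    "cball (\<phi> p) (2 * r) \<subseteq> \<phi> ` (U \<inter> bdom L i)"
    "open (U \<inter> bdom L i \<inter> \<phi> -` ball (\<phi> p) r)" "p \<in> U \<inter> bdom L i \<inter> \<phi> -` ball (\<phi> p) r"
proof -
  have "p \<in> (\<Union>(U, \<phi>)\<in>\<A>. U)" "p \<in> (\<Union>i\<in>bidx L. bdom L i)"
    using manifold hol_bundle
    by (simp_all add: compact_complex_manifold_def hol_atlas_def hol_line_bundle_def)
  then obtain U \<phi> i where c: "(U, \<phi>) \<in> \<A>" "p \<in> U" "i \<in> bidx L" "p \<in> bdom L i"
    by auto
  have "\<phi> p \<in> \<phi> ` (U \<inter> bdom L i)" using c by auto
  then obtain e where e: "e > 0" "cball (\<phi> p) e \<subseteq> \<phi> ` (U \<inter> bdom L i)"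
    using chart_image_open[OF c(1,3)] open_contains_cball by blast
  have "open (U \<inter> bdom L i \<inter> \<phi> -` ball (\<phi> p) (e / 2))"
    using c by (intro continuous_open_preimage open_Int bdom_open chart_open
        continuous_on_subset[OF chart_continuous]) auto
  then show ?thesis using that[of U \<phi> i "e / 2"] c e by auto
qed

lemma finite_open_cover:
  assumes "\<And>p::'p. \<exists>V. open V \<and> p \<in> V \<and> P V"
  obtains \<V> where "finite \<V>" "\<Union>\<V> = UNIV" "\<And>V. V \<in> \<V> \<Longrightarrow> open V \<and> P V"
proof -
  have "compact (UNIV :: 'p set)" using manifold by (simp add: compact_complex_manifold_def)
  moreover have "UNIV \<subseteq> \<Union>{V. open V \<and> P V}" using assms by blast
  ultimately obtain \<V> where "\<V> \<subseteq> {V. open V \<and> P V}" "finite \<V>" "UNIV \<subseteq> \<Union>\<V>"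
    by (rule compactE) auto
  then show ?thesis by (intro that[of \<V>]) auto
qed

lemma metric_chart:
  assumes "(U, \<phi>) \<in> \<A>" "i \<in> bidx L"
  shows metric_smooth: "Ck_on n (\<lambda>z. h i (inv_into U \<phi> z)) (\<phi> ` (U \<inter> bdom L i))"
    and metric_chart_pos: "\<And>z. z \<in> \<phi> ` (U \<inter> bdom L i) \<Longrightarrow> 0 < h i (inv_into U \<phi> z)"
proof -
  have "smooth_on_mfd \<A> (bdom L i) (h i)" and pos: "\<And>p. p \<in> bdom L i \<Longrightarrow> 0 < h i p"
    using metric assms(2) unfolding hermitian_metric_def by blast+
  then show "Ck_on n (\<lambda>z. h i (inv_into U \<phi> z)) (\<phi> ` (U \<inter> bdom L i))"
    using assms(1) by (auto simp: smooth_on_mfd_def smooth_fun_on_def)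
  show "0 < h i (inv_into U \<phi> z)" if "z \<in> \<phi> ` (U \<inter> bdom L i)" for z
    using that pos chart_inv[OF assms] by auto
qed

text \<open>
  Near each point the density \<open>det g\<close> is continuous, hence bounded on a ball; compactness of the manifold
  leaves finitely many such balls.
\<close>

lemma volume_finite:
  assumes vol: "kaehler_volume \<A> L h vol"
  shows "finite_measure vol"
proof -
  have sets: "sets vol = sets borel"
    and density: "\<forall>(U, \<phi>)\<in>\<A>. \<forall>i\<in>bidx L. \<forall>E\<in>sets borel. E \<subseteq> U \<inter> bdom L i \<longrightarrow>
        emeasure vol E =
          (\<integral>\<^sup>+ z\<in>\<phi> ` E. ennreal (Re (det (curvature_matrix (U, \<phi>) (h i) z))) \<partial>lborel)"
    using vol unfolding kaehler_volume_def by blast+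
  have space: "space vol = UNIV" using sets_eq_imp_space_eq[OF sets] by simp
  have "\<exists>V. open V \<and> p \<in> V \<and> emeasure vol V < \<infinity>" for p
  proof -
    obtain U \<phi> i r where c: "(U, \<phi>) \<in> \<A>" "i \<in> bidx L" "0 < r"
      "cball (\<phi> p) (2 * r) \<subseteq> \<phi> ` (U \<inter> bdom L i)"
      "open (U \<inter> bdom L i \<inter> \<phi> -` ball (\<phi> p) r)" "p \<in> U \<inter> bdom L i \<inter> \<phi> -` ball (\<phi> p) r"
      by (rule chart_neighbourhood)
    define V where "V = U \<inter> bdom L i \<inter> \<phi> -` ball (\<phi> p) r"
    define \<delta> where "\<delta> z = Re (det (curvature_matrix (U, \<phi>) (h i) z))" for z
    have "continuous_on (\<phi> ` (U \<inter> bdom L i)) (\<lambda>z. det (curvature_matrix (U, \<phi>) (h i) z))"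
      using curvature_entry_continuous[OF metric_smooth[OF c(1,2)] chart_image_open[OF c(1,2)]
          metric_chart_pos[OF c(1,2)]]
      by (intro det_continuous) (auto simp: curvature_matrix_def intro!: continuous_intros)
    then have "continuous_on (\<phi> ` (U \<inter> bdom L i)) \<delta>"
      unfolding \<delta>_def by (intro continuous_intros)
    then have "compact (\<delta> ` cball (\<phi> p) (2 * r))"
      by (intro compact_continuous_image continuous_on_subset[OF _ c(4)] compact_cball)
    then have "bounded (\<delta> ` cball (\<phi> p) (2 * r))" by (rule compact_imp_bounded)
    then obtain K where K: "\<And>z. z \<in> cball (\<phi> p) (2 * r) \<Longrightarrow> \<bar>\<delta> z\<bar> \<le> K"
      by (auto simp: bounded_iff simp del: mem_cball)
    have "V \<in> sets borel" using c(5) by (simp add: V_def)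
    moreover have "V \<subseteq> U \<inter> bdom L i" by (auto simp: V_def)
    ultimately have "emeasure vol V = (\<integral>\<^sup>+ z\<in>\<phi> ` V. ennreal (\<delta> z) \<partial>lborel)"
      using bspec[OF density c(1), unfolded prod.case] c(2) unfolding \<delta>_def by blast
    also have "\<dots> \<le> (\<integral>\<^sup>+ z. ennreal K * indicator (cball (\<phi> p) (2 * r)) z \<partial>lborel)"
    proof (rule nn_integral_mono)
      fix z
      show "ennreal (\<delta> z) * indicator (\<phi> ` V) z \<le> ennreal K * indicator (cball (\<phi> p) (2 * r)) z"
      proof (cases "z \<in> \<phi> ` V")
        case True
        then have "z \<in> cball (\<phi> p) (2 * r)" using c(3) by (auto simp: V_def)
        moreover from K[OF this] have "ennreal (\<delta> z) \<le> ennreal K" by (intro ennreal_leI) simp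
        ultimately show ?thesis using True by (simp add: indicator_def)
      qed simp
    qed
    also have "\<dots> = ennreal K * emeasure lborel (cball (\<phi> p) (2 * r))"
      by (rule nn_integral_cmult_indicator) simp
    also have "\<dots> < \<infinity>"
      using emeasure_lborel_cball_finite[of "\<phi> p" "2 * r"] by (simp add: ennreal_mult_less_top)
    finally show ?thesis using c(5,6) unfolding V_def by blast
  qed
  from finite_open_cover[OF this] obtain \<V>
    where \<V>: "finite \<V>" "\<Union>\<V> = UNIV" "\<And>V. V \<in> \<V> \<Longrightarrow> open V \<and> emeasure vol V < \<infinity>" by metis
  have "emeasure vol (\<Union>V\<in>\<V>. V) \<le> (\<Sum>V\<in>\<V>. emeasure vol V)"
    using \<V> by (intro emeasure_subadditive_finite) (auto simp: sets)
  also have "\<dots> < \<infinity>" using \<V> by (simp add: ennreal_sum_less_top)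
  finally show ?thesis using \<V>(2) by (intro finite_measureI) (simp add: space)
qed

lemma pt_inner_frame:
  assumes s: "s \<in> H0 \<A> L d" and t: "t \<in> H0 \<A> L d" and i: "i \<in> bidx L" "p \<in> bdom L i"
  shows "pt_inner L h d s t p = s i p * cnj (t i p) * complex_of_real (h i p ^ d)"
proof -
  define j where "j = frame_at L p"
  have "\<exists>j. j \<in> bidx L \<and> p \<in> bdom L j" using i by blast
  then have j: "j \<in> bidx L" "p \<in> bdom L j"
    unfolding j_def frame_at_def by (metis (mono_tags, lifting) someI_ex)+
  define g where "g = btrans L i j p"
  have st: "s i p = g ^ d * s j p" "t i p = g ^ d * t j p"
    using s t i j unfolding H0_def g_def by blast+
  have hh: "h j p = (cmod g)\<^sup>2 * h i p"
    using metric i j unfolding hermitian_metric_def g_def by blast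
  have "complex_of_real (h j p) = g * cnj g * complex_of_real (h i p)"
    unfolding hh by (simp add: complex_norm_square[symmetric])
  then have "pt_inner L h d s t p = s j p * cnj (t j p) * (g * cnj g * complex_of_real (h i p)) ^ d"
    by (simp add: pt_inner_def j_def Let_def)
  then show ?thesis by (simp add: st power_mult_distrib mult_ac)
qed

lemma pt_norm_frame:
  assumes s: "s \<in> H0 \<A> L d" and i: "i \<in> bidx L" "p \<in> bdom L i"
  shows "pt_norm L h d s p = cmod (s i p) * sqrt (h i p ^ d)"
proof -
  have "s i p * cnj (s i p) * complex_of_real (h i p ^ d) = complex_of_real ((cmod (s i p))\<^sup>2 * h i p ^ d)"
    by (simp only: of_real_mult complex_norm_square)
  then have "Re (pt_inner L h d s s p) = (cmod (s i p))\<^sup>2 * h i p ^ d"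
    unfolding pt_inner_frame[OF s s i] by (simp only: Re_complex_of_real)
  then show ?thesis by (simp add: pt_norm_def real_sqrt_mult)
qed

lemma frame_at: "frame_at L p \<in> bidx L \<and> p \<in> bdom L (frame_at L p)"
proof -
  have "(\<Union>i\<in>bidx L. bdom L i) = UNIV" using hol_bundle by (simp add: hol_line_bundle_def)
  then have "\<exists>j. j \<in> bidx L \<and> p \<in> bdom L j" by blast
  then show ?thesis unfolding frame_at_def by (rule someI_ex)
qed

lemma metric_pos: "i \<in> bidx L \<Longrightarrow> p \<in> bdom L i \<Longrightarrow> 0 < h i p"
  using metric unfolding hermitian_metric_def by blast

lemma section_chart_hol:
  assumes "s \<in> H0 \<A> L d" "(U, \<phi>) \<in> \<A>" "i \<in> bidx L"
  shows "hol_fun_on (\<lambda>z. s i (inv_into U \<phi> z)) (\<phi> ` (U \<inter> bdom L i))"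
  using assms unfolding H0_def hol_on_mfd_def by blast

lemma continuous_on_chart:
  assumes c: "(U, \<phi>) \<in> \<A>" "i \<in> bidx L"
    and f: "continuous_on (\<phi> ` (U \<inter> bdom L i)) (\<lambda>z. f (inv_into U \<phi> z))"
  shows "continuous_on (U \<inter> bdom L i) f"
proof -
  have "continuous_on (U \<inter> bdom L i) (\<lambda>q. f (inv_into U \<phi> (\<phi> q)))"
    by (rule continuous_on_compose2[OF f continuous_on_subset[OF chart_continuous[OF c]]]) auto
  then show ?thesis by (rule continuous_on_eq) (simp add: chart_inv[OF c])
qed

lemma pt_inner_continuous:
  assumes s: "s \<in> H0 \<A> L d" and t: "t \<in> H0 \<A> L d"
  shows "continuous_on UNIV (pt_inner L h d s t)"
proof (intro continuous_at_imp_continuous_on ballI)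
  fix p :: 'p
  obtain U \<phi> i r where c: "(U, \<phi>) \<in> \<A>" "i \<in> bidx L"
      "p \<in> U \<inter> bdom L i \<inter> \<phi> -` ball (\<phi> p) r"
    by (rule chart_neighbourhood)
  have sec: "continuous_on (U \<inter> bdom L i) (s i)" if "s \<in> H0 \<A> L d" for s
  proof (rule continuous_on_chart[OF c(1,2)])
    show "continuous_on (\<phi> ` (U \<inter> bdom L i)) (\<lambda>z. s i (inv_into U \<phi> z))"
      using section_chart_hol[OF that c(1,2)] unfolding hol_fun_on_def
      by (intro continuous_at_imp_continuous_on) (blast intro: has_derivative_continuous)
  qed
  have "continuous_on (U \<inter> bdom L i) (h i)"
    using metric_smooth[OF c(1,2), of 0] by (intro continuous_on_chart[OF c(1,2)]) simp
  then have "continuous_on (U \<inter> bdom L i) (\<lambda>q. s i q * cnj (t i q) * complex_of_real (h i q ^ d))"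
    by (intro continuous_intros sec s t)
  then have "continuous_on (U \<inter> bdom L i) (pt_inner L h d s t)"
    by (rule continuous_on_eq) (simp add: pt_inner_frame[OF s t c(2)])
  moreover have "open (U \<inter> bdom L i)" using c by (intro open_Int chart_open bdom_open)
  ultimately show "isCont (pt_inner L h d s t) p"
    using c(3) continuous_on_eq_continuous_at by blast
qed

lemma pt_norm_continuous: "s \<in> H0 \<A> L d \<Longrightarrow> continuous_on UNIV (pt_norm L h d s)"
  unfolding pt_norm_def by (intro continuous_intros pt_inner_continuous)

lemma bounded_of_continuous:
  fixes f :: "'p \<Rightarrow> 'b::real_normed_vector"
  assumes "continuous_on UNIV f"
  shows "\<exists>K. \<forall>p. norm (f p) \<le> K"
proof -
  have "compact (range f)"
    using assms manifold by (intro compact_continuous_image) (simp_all add: compact_complex_manifold_def)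
  then have "bounded (range f)" by (rule compact_imp_bounded)
  then show ?thesis by (auto simp: bounded_iff)
qed

lemma pt_norm_nonneg: "s \<in> H0 \<A> L d \<Longrightarrow> 0 \<le> pt_norm L h d s p"
  using pt_norm_frame frame_at metric_pos by (metis norm_ge_zero mult_nonneg_nonneg real_sqrt_ge_zero
      zero_le_power less_imp_le)

lemma pt_norm_le_sup_norm:
  assumes "s \<in> H0 \<A> L d"
  shows "pt_norm L h d s p \<le> sup_norm L h d s"
proof -
  obtain K where "\<And>p. norm (pt_norm L h d s p) \<le> K"
    using bounded_of_continuous[OF pt_norm_continuous[OF assms]] by blast
  then have "bdd_above (range (pt_norm L h d s))" by (intro bdd_aboveI2[of _ _ K]) (auto simp: abs_le_iff)
  then show ?thesis unfolding sup_norm_def by (rule cSUP_upper[OF UNIV_I])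
qed

text \<open>
  The net of a coordinate ball, pulled back by the chart. The term \<open>sup_norm / 2\<close> on the right is the
  oscillation allowed by \<open>weighted_oscillation\<close>; it is absorbed in \<open>global_net\<close>, where \<open>x\<close> ranges over all
  points.
\<close>

lemma local_net:
  "\<exists>V. open V \<and> p \<in> V \<and> (\<exists>K a. \<forall>d\<ge>1. \<exists>F. finite F \<and> card F \<le> K * d ^ a \<and>
     (\<forall>s\<in>H0 \<A> L d. \<forall>x\<in>V. \<exists>y\<in>F. pt_norm L h d s x \<le> 2 * pt_norm L h d s y + sup_norm L h d s / 2))"
proof -
  obtain U \<phi> i r where c: "(U, \<phi>) \<in> \<A>" "i \<in> bidx L" "0 < r"
    "cball (\<phi> p) (2 * r) \<subseteq> \<phi> ` (U \<inter> bdom L i)"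
    "open (U \<inter> bdom L i \<inter> \<phi> -` ball (\<phi> p) r)" "p \<in> U \<inter> bdom L i \<inter> \<phi> -` ball (\<phi> p) r"
    by (rule chart_neighbourhood)
  define \<psi> where "\<psi> = inv_into U \<phi>"
  define u where "u = (\<lambda>z. h i (\<psi> z))"
  have \<psi>: "\<psi> z \<in> U \<inter> bdom L i" if "z \<in> \<phi> ` (U \<inter> bdom L i)" for z
    using that chart_inv[OF c(1,2)] by (auto simp: \<psi>_def)
  obtain \<Lambda> where \<Lambda>: "\<Lambda> \<ge> 0" "\<And>z w. \<lbrakk>z \<in> cball (\<phi> p) (2 * r); w \<in> cball (\<phi> p) (2 * r)\<rbrakk> \<Longrightarrow>
      u z \<le> u w * (1 + \<Lambda> * dist z w)"
    using C1_positive_ratio_bound[OF metric_smooth[OF c(1,2)] c(4) metric_chart_pos[OF c(1,2)]]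
    by (auto simp: u_def \<psi>_def)
  \<comment> \<open>So small that the weight to the power d changes by a bounded factor within \<rho>/d.\<close>
  define \<rho> where "\<rho> = min r (1 / (\<Lambda> + 1))"
  have \<rho>: "0 < \<rho>" "\<rho> \<le> r" "\<Lambda> * \<rho> \<le> 1"
  proof -
    show "0 < \<rho>" "\<rho> \<le> r" using c(3) \<Lambda>(1) by (auto simp: \<rho>_def)
    have "\<Lambda> * \<rho> \<le> \<Lambda> * (1 / (\<Lambda> + 1))" using \<Lambda>(1) by (intro mult_left_mono) (auto simp: \<rho>_def)
    also have "\<dots> \<le> 1" using \<Lambda>(1) by (simp add: field_simps)
    finally show "\<Lambda> * \<rho> \<le> 1" .
  qed
  obtain K a where K: "\<And>d. d \<ge> 1 \<Longrightarrow> \<exists>F\<subseteq>ball (\<phi> p) r. finite F \<and> card F \<le> K * d ^ a \<and>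
      (\<forall>z\<in>ball (\<phi> p) r. \<exists>y\<in>F. dist z y \<le> \<rho> / 16 / real d)"
    using polynomial_net[OF bounded_ball, of "\<rho> / 16" "\<phi> p" r] \<rho>(1) by auto
  have sub: "ball (\<phi> p) (2 * r) \<subseteq> \<phi> ` (U \<inter> bdom L i)" using c(4) ball_subset_cball by blast
  have "\<exists>F. finite F \<and> card F \<le> K * d ^ a \<and> (\<forall>s\<in>H0 \<A> L d. \<forall>x\<in>U \<inter> bdom L i \<inter> \<phi> -` ball (\<phi> p) r.
      \<exists>y\<in>F. pt_norm L h d s x \<le> 2 * pt_norm L h d s y + sup_norm L h d s / 2)" if d: "d \<ge> 1" for d
  proof -
    obtain F where F: "F \<subseteq> ball (\<phi> p) r" "finite F" "card F \<le> K * d ^ a"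
      "\<And>z. z \<in> ball (\<phi> p) r \<Longrightarrow> \<exists>y\<in>F. dist z y \<le> \<rho> / 16 / real d"
      using K[OF d] by blast
    have "\<exists>y\<in>\<psi> ` F. pt_norm L h d s x \<le> 2 * pt_norm L h d s y + sup_norm L h d s / 2"
      if s: "s \<in> H0 \<A> L d" and x: "x \<in> U \<inter> bdom L i \<inter> \<phi> -` ball (\<phi> p) r" for s x
    proof -
      have norm: "cmod (s i (\<psi> w)) * sqrt (u w ^ d) = pt_norm L h d s (\<psi> w)"
        if "w \<in> ball (\<phi> p) (2 * r)" for w
        using pt_norm_frame[OF s c(2), of "\<psi> w"] \<psi>[of w] that sub by (auto simp: u_def)
      have z: "\<phi> x \<in> ball (\<phi> p) r" using x by simp
      have b2: "w \<in> ball (\<phi> p) (2 * r)" if "w \<in> ball (\<phi> p) r" for w using that c(3) by auto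
      obtain y where y: "y \<in> F" "dist (\<phi> x) y \<le> \<rho> / 16 / real d" using F(4)[OF z] by blast
      have "cmod (s i (\<psi> (\<phi> x))) * sqrt (u (\<phi> x) ^ d)
          \<le> 2 * (cmod (s i (\<psi> y)) * sqrt (u y ^ d)) + sup_norm L h d s / 2"
      proof (rule weighted_oscillation[where f = "\<lambda>z. s i (\<psi> z)" and c = "\<phi> p" and r = r])
        show "hol_fun_on (\<lambda>z. s i (\<psi> z)) (ball (\<phi> p) (2 * r))"
          using section_chart_hol[OF s c(1,2)] sub unfolding hol_fun_on_def \<psi>_def by blast
        show "0 < u w" if "w \<in> ball (\<phi> p) (2 * r)" for w
          using metric_chart_pos[OF c(1,2)] that sub by (auto simp: u_def \<psi>_def)
        show "u z \<le> u w * (1 + \<Lambda> * dist z w)" if "z \<in> ball (\<phi> p) (2 * r)" "w \<in> ball (\<phi> p) (2 * r)" for z w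
          using \<Lambda>(2) that ball_subset_cball by blast
        show "cmod (s i (\<psi> w)) * sqrt (u w ^ d) \<le> sup_norm L h d s" if "w \<in> ball (\<phi> p) (2 * r)" for w
          unfolding norm[OF that] by (rule pt_norm_le_sup_norm[OF s])
      qed (use \<rho> \<Lambda>(1) d z y in auto)
      moreover have "y \<in> ball (\<phi> p) r" using y F(1) by blast
      moreover have "\<psi> (\<phi> x) = x" using x chart_inv[OF c(1,2)] by (auto simp: \<psi>_def)
      ultimately have "pt_norm L h d s x \<le> 2 * pt_norm L h d s (\<psi> y) + sup_norm L h d s / 2"
        using norm[OF b2] norm[OF b2[OF z]] by simp
      then show ?thesis using y(1) by blast
    qed
    moreover have "card (\<psi> ` F) \<le> K * d ^ a" using card_image_le[OF F(2), of \<psi>] F(3) by linarith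
    ultimately show ?thesis using F(2) by (intro exI[of _ "\<psi> ` F"]) auto
  qed
  then show ?thesis using c(5,6) by blast
qed

text \<open>
  The union of the local nets over a finite cover. If \<open>y\<close> has the largest norm on it, the local bounds
  give \<open>sup |s| \<le> 2 |s(y)| + (sup |s|)/2\<close>, and the supremum is finite.
\<close>

lemma global_net:
  "\<exists>K a. \<forall>d\<ge>1. \<exists>F. finite F \<and> card F \<le> K * d ^ a \<and>
     (\<forall>s\<in>H0 \<A> L d. \<exists>y\<in>F. sup_norm L h d s \<le> 4 * pt_norm L h d s y)"
proof -
  obtain \<V> where \<V>: "finite \<V>" "\<Union>\<V> = UNIV"
    and "\<And>V. V \<in> \<V> \<Longrightarrow> open V \<and> (\<exists>K a. \<forall>d\<ge>1. \<exists>F. finite F \<and> card F \<le> K * d ^ a \<and>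
     (\<forall>s\<in>H0 \<A> L d. \<forall>x\<in>V. \<exists>y\<in>F. pt_norm L h d s x \<le> 2 * pt_norm L h d s y + sup_norm L h d s / 2))"
    using finite_open_cover[OF local_net] by blast
  then have "\<forall>V\<in>\<V>. \<exists>K a. \<forall>d\<ge>1. \<exists>F. finite F \<and> card F \<le> K * d ^ a \<and>
     (\<forall>s\<in>H0 \<A> L d. \<forall>x\<in>V. \<exists>y\<in>F. pt_norm L h d s x \<le> 2 * pt_norm L h d s y + sup_norm L h d s / 2)"
    by blast
  then obtain K a where Ka: "\<And>V d. \<lbrakk>V \<in> \<V>; d \<ge> 1\<rbrakk> \<Longrightarrow> \<exists>F. finite F \<and> card F \<le> K V * d ^ a V \<and>
     (\<forall>s\<in>H0 \<A> L d. \<forall>x\<in>V. \<exists>y\<in>F. pt_norm L h d s x \<le> 2 * pt_norm L h d s y + sup_norm L h d s / 2)"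
    by metis
  define K' where "K' = (\<Sum>V\<in>\<V>. K V)"
  define a' where "a' = (\<Sum>V\<in>\<V>. a V)"
  have "\<exists>F. finite F \<and> card F \<le> K' * d ^ a' \<and>
     (\<forall>s\<in>H0 \<A> L d. \<exists>y\<in>F. sup_norm L h d s \<le> 4 * pt_norm L h d s y)" if d: "d \<ge> 1" for d
  proof -
    obtain F where F: "\<And>V. V \<in> \<V> \<Longrightarrow> finite (F V)" "\<And>V. V \<in> \<V> \<Longrightarrow> card (F V) \<le> K V * d ^ a V"
      "\<And>V s x. \<lbrakk>V \<in> \<V>; s \<in> H0 \<A> L d; x \<in> V\<rbrakk> \<Longrightarrow>
         \<exists>y\<in>F V. pt_norm L h d s x \<le> 2 * pt_norm L h d s y + sup_norm L h d s / 2"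
      using Ka[OF _ d] by metis
    define G where "G = (\<Union>V\<in>\<V>. F V)"
    have finG: "finite G" using \<V> F by (auto simp: G_def)
    have "card G \<le> (\<Sum>V\<in>\<V>. card (F V))" unfolding G_def by (rule card_UN_le[OF \<V>(1)])
    also have "\<dots> \<le> (\<Sum>V\<in>\<V>. K V * d ^ a')"
    proof (rule sum_mono)
      fix V assume V: "V \<in> \<V>"
      have "a V \<le> a'" unfolding a'_def by (rule member_le_sum[OF V]) (use \<V>(1) in auto)
      then have "d ^ a V \<le> d ^ a'" using d by (intro power_increasing) auto
      then have "K V * d ^ a V \<le> K V * d ^ a'" by (rule mult_left_mono) simp
      then show "card (F V) \<le> K V * d ^ a'" using F(2)[OF V] by linarith
    qed
    also have "\<dots> = K' * d ^ a'" by (simp add: K'_def sum_distrib_right)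
    finally have card: "card G \<le> K' * d ^ a'" .
    have ex: "\<exists>y\<in>G. pt_norm L h d s x \<le> 2 * pt_norm L h d s y + sup_norm L h d s / 2"
      if "s \<in> H0 \<A> L d" for s x
    proof -
      have "x \<in> \<Union>\<V>" by (simp add: \<V>(2))
      then obtain V where V: "V \<in> \<V>" "x \<in> V" by auto
      show ?thesis using F(3)[OF V(1) that V(2)] V(1) by (auto simp: G_def)
    qed
    have "\<exists>y\<in>G. sup_norm L h d s \<le> 4 * pt_norm L h d s y" if s: "s \<in> H0 \<A> L d" for s
    proof -
      have "G \<noteq> {}" using ex[OF s] by blast
      then have "Max (pt_norm L h d s ` G) \<in> pt_norm L h d s ` G"
        using finG by (intro Max_in) auto
      then obtain y where y: "y \<in> G" "pt_norm L h d s y = Max (pt_norm L h d s ` G)" by auto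
      have max: "pt_norm L h d s z \<le> pt_norm L h d s y" if "z \<in> G" for z
        unfolding y(2) using finG that by (intro Max_ge) auto
      have "pt_norm L h d s x \<le> 2 * pt_norm L h d s y + sup_norm L h d s / 2" for x
        using ex[OF s, of x] max by fastforce
      then have "sup_norm L h d s \<le> 2 * pt_norm L h d s y + sup_norm L h d s / 2"
        unfolding sup_norm_def[of L h d s] by (intro cSUP_least) (auto simp: sup_norm_def)
      then show ?thesis using y(1) by (intro bexI[of _ y]) auto
    qed
    then show ?thesis using finG card by blast
  qed
  then show ?thesis by blast
qed

end

section \<open>The tail of the supremum norm\<close>

context hermitian_bundle
begin

lemma pt_inner_integrable:
  assumes vol: "kaehler_volume \<A> L h vol" and st: "s \<in> H0 \<A> L d" "t \<in> H0 \<A> L d"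
  shows "integrable vol (pt_inner L h d s t)"
proof -
  interpret finite_measure vol by (rule volume_finite[OF vol])
  have sets: "sets vol = sets borel" using vol unfolding kaehler_volume_def by blast
  have "pt_inner L h d s t \<in> borel_measurable borel"
    by (rule borel_measurable_continuous_onI[OF pt_inner_continuous[OF st]])
  then have m: "pt_inner L h d s t \<in> borel_measurable vol"
    using measurable_cong_sets[OF sets refl] by blast
  obtain K where "\<And>p. norm (pt_inner L h d s t p) \<le> K"
    using bounded_of_continuous[OF pt_inner_continuous[OF st]] by blast
  then show ?thesis by (intro integrable_const_bound[OF _ m]) auto
qed

lemma section_form_L2:
  assumes vol: "kaehler_volume \<A> L h vol"
    and W: "module.subspace sscale W" "W \<subseteq> H0 \<A> L d" and dim: "0 < vector_space.dim sscale W"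
  shows "section_form W (L2_inner L h vol d)"
proof
  show "sec.subspace W" by (rule W)
  obtain B where "B \<subseteq> W" "sec.independent B" "W \<subseteq> sec.span B" "card B = sec.dim W"
    using sec.basis_exists by blast
  then show "\<exists>B. finite B \<and> B \<subseteq> W \<and> W \<subseteq> sec.span B"
    using dim by (intro exI[of _ B]) (auto intro: card_ge_0_finite)
next
  have int: "integrable vol (pt_inner L h d s t)" if "s \<in> W" "t \<in> W" for s t
    using that W(2) by (intro pt_inner_integrable[OF vol]) auto
  show "L2_inner L h vol d (s + t) r = L2_inner L h vol d s r + L2_inner L h vol d t r"
    if "s \<in> W" "t \<in> W" "r \<in> W" for s t r
  proof -
    have "pt_inner L h d (s + t) r = (\<lambda>p. pt_inner L h d s r p + pt_inner L h d t r p)"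
      by (simp add: pt_inner_def Let_def fun_eq_iff algebra_simps)
    then show ?thesis using int that by (simp add: L2_inner_def)
  qed
  show "L2_inner L h vol d (sscale c s) t = c * L2_inner L h vol d s t"
    if "s \<in> W" "t \<in> W" for c s t
  proof -
    have "pt_inner L h d (sscale c s) t = (\<lambda>p. c * pt_inner L h d s t p)"
      by (simp add: pt_inner_def Let_def fun_eq_iff sscale_apply algebra_simps)
    then show ?thesis by (simp add: L2_inner_def)
  qed
  show "L2_inner L h vol d t s = cnj (L2_inner L h vol d s t)" if "s \<in> W" "t \<in> W" for s t
  proof -
    have "pt_inner L h d t s = (\<lambda>p. cnj (pt_inner L h d s t p))"
      by (simp add: pt_inner_def Let_def fun_eq_iff mult_ac)
    then show ?thesis by (simp add: L2_inner_def)
  qed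
  show "0 \<le> Re (L2_inner L h vol d s s)" if "s \<in> W" for s
  proof -
    have "Re (L2_inner L h vol d s s) = (\<integral>p. Re (pt_inner L h d s s p) \<partial>vol)"
      unfolding L2_inner_def by (rule integral_Re[symmetric]) (rule int[OF that that])
    moreover have "0 \<le> Re (pt_inner L h d s s p)" for p
      using pt_norm_nonneg[of s d p] that W(2) by (auto simp: pt_norm_def)
    ultimately show ?thesis by simp
  qed
qed

lemma haar_form_L2:
  assumes vol: "kaehler_volume \<A> L h vol"
    and W: "module.subspace sscale W" "W \<subseteq> H0 \<A> L d" and dim: "0 < vector_space.dim sscale W"
    and haar: "haar_sphere_measure L h vol d W \<mu>"
  shows "haar_form W (L2_inner L h vol d) \<mu>"
proof -
  interpret section_form W "L2_inner L h vol d" by (rule section_form_L2[OF vol W dim])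
  have sp: "unit_sphere L h vol d W = usphere"
    by (simp add: unit_sphere_def usphere_def L2_norm_def)
  have "unitary_on L h vol d W T \<longleftrightarrow> unitary T" for T
    by (simp add: unitary_on_def unitary_def)
  then show ?thesis
    using haar unfolding haar_sphere_measure_def sp by unfold_locales auto
qed

text \<open>
  The factor 4 lost by passing to the net and the squares account for the constant: \<open>32 = 2 * 4\<^sup>2\<close>.
  The supremum exceeds the threshold only on the union of the events at the points of the net.
\<close>

lemma sup_norm_tail:
  assumes vol: "kaehler_volume \<A> L h vol"
    and W: "module.subspace sscale W" "W \<subseteq> H0 \<A> L d" and k: "vector_space.dim sscale W = k" "0 < k"
    and haar: "haar_sphere_measure L h vol d W \<mu>"
    and F: "finite F" "\<And>s. s \<in> H0 \<A> L d \<Longrightarrow> \<exists>y\<in>F. sup_norm L h d s \<le> 4 * pt_norm L h d s y"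
    and \<alpha>: "\<alpha> = (SUP x. kernel_diag L h vol d W x / real k)"
    and T: "0 < T"
  shows "measure \<mu> {s \<in> unit_sphere L h vol d W. sup_norm L h d s > sqrt (\<alpha> * T)}
     \<le> real (card F) * (32 * real n / T) ^ n"
proof -
  interpret haar_form W "L2_inner L h vol d" \<mu>
    by (rule haar_form_L2[OF vol W _ haar]) (use k in simp)
  have sp: "unit_sphere L h vol d W = usphere"
    by (simp add: unit_sphere_def usphere_def L2_norm_def)
  have onb: "orthonormal_basis L h vol d W B \<longleftrightarrow> orthonormal_set B \<and> W \<subseteq> sec.span B" for B
    by (auto simp: orthonormal_basis_def orthonormal_set_def)
  define B where "B = (SOME B. orthonormal_basis L h vol d W B)"
  have "orthonormal_basis L h vol d W B"
    unfolding B_def by (rule someI_ex) (use onb_exists onb in blast)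
  then have B: "orthonormal_set B" "W \<subseteq> sec.span B" by (simp_all add: onb)
  have card: "card B = k" using card_onb[OF B] k by simp
  then have B0: "B \<noteq> {}" using k by auto
  have BH: "b \<in> H0 \<A> L d" if "b \<in> B" for b using that B W(2) by (auto simp: orthonormal_set_def)
  have ker: "kernel_diag L h vol d W x = (\<Sum>b\<in>B. (pt_norm L h d b x)\<^sup>2)" for x
    by (simp add: kernel_diag_def B_def)
  have "continuous_on UNIV (\<lambda>x. kernel_diag L h vol d W x / real k)"
    unfolding ker using k by (intro continuous_intros pt_norm_continuous BH) auto
  from bounded_of_continuous[OF this] obtain K
    where "\<And>x. norm (kernel_diag L h vol d W x / real k) \<le> K" by blast
  then have "kernel_diag L h vol d W x / real k \<le> K" for x
    unfolding real_norm_def by (rule order_trans[OF abs_ge_self])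
  then have "bdd_above (range (\<lambda>x. kernel_diag L h vol d W x / real k))"
    by (rule bdd_aboveI2)
  then have le_\<alpha>: "kernel_diag L h vol d W x / real k \<le> \<alpha>" for x
    unfolding \<alpha> by (rule cSUP_upper[OF UNIV_I])
  have \<alpha>0: "0 \<le> \<alpha>"
    by (rule order_trans[OF _ le_\<alpha>]) (simp add: ker sum_nonneg)
  define E where "E y = {s \<in> usphere. sqrt (\<alpha> * T) / 4 < pt_norm L h d s y}" for y
  have sphH: "s \<in> H0 \<A> L d" if "s \<in> usphere" for s using that W(2) by (auto simp: usphere_def)
  have Em: "E y \<in> sets \<mu>" and tail: "measure \<mu> (E y) \<le> (32 * real n / T) ^ n" for y
  proof -
    define i where "i = frame_at L y"
    have i: "i \<in> bidx L" "y \<in> bdom L i" using frame_at[of y] by (auto simp: i_def)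
    define w where "w = sqrt (h i y ^ d)"
    have w: "w > 0" using metric_pos[OF i] by (simp add: w_def)
    have nrm: "pt_norm L h d s y = cmod (s i y) * w" if "s \<in> H0 \<A> L d" for s
      using pt_norm_frame[OF that i] by (simp add: w_def)
    \<comment> \<open>The weight w translates norms into coefficients: a bounds the kernel of the coefficient at y,
        and the square root of a t is the threshold for the coefficient.\<close>
    define a where "a = real k * \<alpha> / w\<^sup>2"
    define t where "t = T / (16 * real k)"
    have t: "t > 0" using T k by (simp add: t_def)
    have "(\<Sum>b\<in>B. (cmod (b i y))\<^sup>2) * w\<^sup>2 = kernel_diag L h vol d W y"
      unfolding ker sum_distrib_right by (intro sum.cong) (simp_all add: nrm[OF BH] power_mult_distrib)
    then have "(\<Sum>b\<in>B. (cmod (b i y))\<^sup>2) = kernel_diag L h vol d W y / w\<^sup>2"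
      using w by (simp add: field_simps)
    also have "\<dots> \<le> a"
      unfolding a_def using le_\<alpha>[of y] k w by (intro divide_right_mono) (auto simp: field_simps)
    finally have a: "(\<Sum>b\<in>B. (cmod (b i y))\<^sup>2) \<le> a" .
    have "a * t = (sqrt (\<alpha> * T) / 4 / w)\<^sup>2"
      using k \<alpha>0 T by (simp add: a_def t_def power_divide field_simps)
    then have root: "sqrt (a * t) = sqrt (\<alpha> * T) / 4 / w"
      using w \<alpha>0 T by simp
    have "sqrt (\<alpha> * T) / 4 < pt_norm L h d s y \<longleftrightarrow> sqrt (a * t) < cmod (s i y)" if "s \<in> usphere" for s
      unfolding nrm[OF sphH[OF that]] root by (rule pos_divide_less_eq[OF w, symmetric])
    then have E: "E y = {s \<in> usphere. sqrt (a * t) < cmod (s i y)}"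
      unfolding E_def by auto
    have [measurable]: "(\<lambda>s. cmod (s i y)) \<in> borel_measurable \<mu>"
      using measurable_eval by measurable
    have "{s \<in> space \<mu>. sqrt (a * t) < cmod (s i y)} \<in> sets \<mu>" by measurable
    then show "E y \<in> sets \<mu>" by (simp add: E space_\<mu>)
    have "measure \<mu> (E y) \<le> (2 * real n / (real (card B) * t)) ^ n"
      unfolding E by (rule eval_tail[OF B B0 a t])
    also have "2 * real n / (real (card B) * t) = 32 * real n / T"
      using k by (simp add: card t_def)
    finally show "measure \<mu> (E y) \<le> (32 * real n / T) ^ n" .
  qed
  have "measure \<mu> {s \<in> unit_sphere L h vol d W. sup_norm L h d s > sqrt (\<alpha> * T)} \<le> measure \<mu> (\<Union>y\<in>F. E y)"
  proof (rule finite_measure_mono)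
    show "{s \<in> unit_sphere L h vol d W. sup_norm L h d s > sqrt (\<alpha> * T)} \<subseteq> (\<Union>y\<in>F. E y)"
    proof
      fix s assume s: "s \<in> {s \<in> unit_sphere L h vol d W. sup_norm L h d s > sqrt (\<alpha> * T)}"
      then have "s \<in> usphere" by (simp add: sp)
      from F(2)[OF sphH[OF this]] obtain y where "y \<in> F" "sup_norm L h d s \<le> 4 * pt_norm L h d s y" by blast
      then show "s \<in> (\<Union>y\<in>F. E y)" using s \<open>s \<in> usphere\<close> by (auto simp: E_def intro!: bexI[of _ y])
    qed
    show "(\<Union>y\<in>F. E y) \<in> sets \<mu>" using F(1) Em by auto
  qed
  also have "\<dots> \<le> (\<Sum>y\<in>F. measure \<mu> (E y))"
    using F(1) Em by (intro finite_measure_subadditive_finite) auto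
  also have "\<dots> \<le> (\<Sum>y\<in>F. (32 * real n / T) ^ n)" by (intro sum_mono tail)
  finally show ?thesis by simp
qed

end

theorem theorem3p7:
  fixes \<A> :: "('p::t2_space, 'm::finite) chart set"
    and L :: "('p, 'i) line_bundle"
    and h :: "'i \<Rightarrow> 'p \<Rightarrow> real"
    and vol :: "'p measure"
    and W :: "nat \<Rightarrow> ('p, 'i) bsection set"
    and k :: "nat \<Rightarrow> nat"
    and \<mu> :: "nat \<Rightarrow> ('p, 'i) bsection measure"
    and \<alpha> :: "nat \<Rightarrow> real"
  assumes manifold: "compact_complex_manifold \<A>" "algebraic_manifold \<A>"
    and positive_bundle: "hol_line_bundle \<A> L" "hermitian_metric \<A> L h" "positive_metric \<A> L h"
    and volume: "kaehler_volume \<A> L h vol"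
    and W_subspace: "\<And>d. module.subspace sscale (W d)" "\<And>d. W d \<subseteq> H0 \<A> L d"
    and W_dim: "\<And>d. vector_space.dim sscale (W d) = k d"
    and k_growth: "(\<lambda>d. real (k d)) \<in> \<Theta>(\<lambda>d. real d ^ CARD('m))"
    and haar: "\<And>d. k d > 0 \<Longrightarrow> haar_sphere_measure L h vol d (W d) (\<mu> d)"
    and \<alpha>_eq: "\<And>d. \<alpha> d = (SUP x. kernel_diag L h vol d (W d) x / real (k d))"
  shows "(\<exists>C>0. (\<lambda>d. measure (\<mu> d) {s \<in> unit_sphere L h vol d (W d).
             sup_norm L h d s > C * sqrt (\<alpha> d * ln (real d))}) \<in> O(\<lambda>d. 1 / real d))
       \<and> (\<forall>j::nat. \<exists>C>0. (\<lambda>d. measure (\<mu> d) {s \<in> unit_sphere L h vol d (W d).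
             sup_norm L h d s > C * sqrt (\<alpha> d * ln (real d))}) \<in> O(\<lambda>d. 1 / real d ^ j))"
proof -
  interpret hermitian_bundle \<A> L h
    by unfold_locales (rule manifold positive_bundle)+
  obtain K a where net: "\<And>d. d \<ge> 1 \<Longrightarrow> \<exists>F. finite F \<and> card F \<le> K * d ^ a \<and>
     (\<forall>s\<in>H0 \<A> L d. \<exists>y\<in>F. sup_norm L h d s \<le> 4 * pt_norm L h d s y)"
    using global_net by blast
  have "(\<lambda>d. real d ^ CARD('m)) \<in> O(\<lambda>d. real (k d))"
    using k_growth by (simp add: bigtheta_def bigomega_iff_bigo)
  then obtain c where "\<forall>\<^sub>F d in sequentially. norm (real d ^ CARD('m)) \<le> c * norm (real (k d))"
    by (rule landau_o.bigE) blast
  then have k_pos: "\<forall>\<^sub>F d in sequentially. 0 < k d"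
    using eventually_gt_at_top[of 0]
  proof eventually_elim
    case (elim d)
    then show "0 < k d" by (cases "k d = 0") (auto simp: power_le_zero_eq)
  qed
  have main: "\<exists>C>0. (\<lambda>d. measure (\<mu> d) {s \<in> unit_sphere L h vol d (W d).
             sup_norm L h d s > C * sqrt (\<alpha> d * ln (real d))}) \<in> O(\<lambda>d. 1 / real d ^ j)" for j :: nat
  proof -
    define q where "q = real (a + j)"
    \<comment> \<open>The square of C is 64 exp (a + j): the factor exp (- (a + j) log d) pays for the net, which has
        at most K d^a points, and leaves d^(-j).\<close>
    define C where "C = 8 * exp (q / 2)"
    have C: "C > 0" by (simp add: C_def)
    have C2: "C\<^sup>2 = 64 * exp q"
      by (simp add: C_def power_mult_distrib flip: exp_of_nat_mult)
    have "\<forall>\<^sub>F d in sequentially. norm (measure (\<mu> d) {s \<in> unit_sphere L h vol d (W d).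
             sup_norm L h d s > C * sqrt (\<alpha> d * ln (real d))}) \<le> real K * norm (1 / real d ^ j)"
      \<comment> \<open>For d at least 3 the logarithm is at least 1, so that rounding it up at most doubles it.\<close>
      using k_pos eventually_ge_at_top[of 3]
    proof eventually_elim
      case (elim d)
      have d: "real d > 0" using elim by simp
      have "exp 1 \<le> real d" using exp_le elim(2) by (meson numeral_le_real_of_nat_iff order_trans)
      then have ln1: "1 \<le> ln (real d)" using d by (simp add: ln_ge_iff)
      obtain F where F: "finite F" "card F \<le> K * d ^ a"
        "\<And>s. s \<in> H0 \<A> L d \<Longrightarrow> \<exists>y\<in>F. sup_norm L h d s \<le> 4 * pt_norm L h d s y"
        using net[of d] elim by auto
      \<comment> \<open>This order of the moment balances n^n against (log d)^n.\<close>
      define n where "n = nat \<lceil>ln (real d)\<rceil>"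
      have n: "ln (real d) \<le> real n" "real n \<le> 2 * ln (real d)"
        using ln1 unfolding n_def by linarith+
      define T where "T = C\<^sup>2 * ln (real d)"
      have T: "T > 0" using C ln1 by (simp add: T_def)
      have "C * sqrt (\<alpha> d * ln (real d)) = sqrt (\<alpha> d * T)"
        using C by (simp add: T_def real_sqrt_mult)
      then have "measure (\<mu> d) {s \<in> unit_sphere L h vol d (W d).
             sup_norm L h d s > C * sqrt (\<alpha> d * ln (real d))} \<le> real (card F) * (32 * real n / T) ^ n"
        using sup_norm_tail[OF volume W_subspace W_dim elim(1) haar[OF elim(1)] F(1,3) \<alpha>_eq T] by simp
      also have "(32 * real n / T) ^ n \<le> exp (- q) ^ n"
      proof (rule power_mono)
        have "32 * real n / T \<le> 64 * ln (real d) / T"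
          using n(2) T by (intro divide_right_mono) auto
        also have "\<dots> = exp (- q)"
          using ln1 by (simp add: T_def C2 exp_minus field_simps)
        finally show "32 * real n / T \<le> exp (- q)" .
      qed (use T in simp)
      also have "exp (- q) ^ n = exp (- (q * real n))"
        by (simp add: mult.commute flip: exp_of_nat_mult)
      also have "\<dots> \<le> exp (- (q * ln (real d)))"
        using n(1) by (simp add: q_def mult_left_mono)
      also have "\<dots> = 1 / real d ^ (a + j)"
      proof -
        have "exp (q * ln (real d)) = exp (ln (real d)) ^ (a + j)"
          unfolding q_def by (rule exp_of_nat_mult)
        then show ?thesis using d by (simp add: exp_minus divide_inverse)
      qed
      finally have "measure (\<mu> d) {s \<in> unit_sphere L h vol d (W d).
             sup_norm L h d s > C * sqrt (\<alpha> d * ln (real d))} \<le> real (card F) * (1 / real d ^ (a + j))"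
        by (simp add: mult_left_mono)
      also have "\<dots> \<le> real (K * d ^ a) * (1 / real d ^ (a + j))"
        using F(2) by (intro mult_right_mono of_nat_mono) auto
      also have "\<dots> = real K * (1 / real d ^ j)" using d by (simp add: power_add)
      finally show ?case by simp
    qed
    then have "(\<lambda>d. measure (\<mu> d) {s \<in> unit_sphere L h vol d (W d).
             sup_norm L h d s > C * sqrt (\<alpha> d * ln (real d))}) \<in> O(\<lambda>d. 1 / real d ^ j)"
      by (rule bigoI)
    then show ?thesis using C by blast
  qed
  then show ?thesis using main[of 1] by simp
qed

end
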